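(* Let $x>1$ be real, let $a$ be a fixed real number with $-1<a<0$, and let $s\geq 2$ be a fixed integer. Then \begin{multline*} A^{(s)}(x;\phi_{s}) = \frac{\log\sqrt{2\pi}}{\zeta(s+1)^2}\,x\log x + \frac{s\,\zeta'(s+1)}{2\zeta(s+1)^2}\,x + \frac{\log\sqrt{2\pi}}{\zeta(s+1)^2}\left(2\gamma-1-2\frac{\zeta'(s+1)}{\zeta(s+1)}-\zeta(s+1)\right)x \\ + \log\sqrt{2\pi}\sum_{d\leq x}\frac{(\mu*\mu)(d)}{d^s}\Delta\!\left(\frac{x}{d}\right) + \frac{s}{2}\sum_{d\leq x}\frac{(\mu*\Lambda)(d)}{d^s}\vartheta\!\left(\frac{x}{d}\right) - \frac{s\,\zeta'(s)}{4\zeta(s)^2} - \log\sqrt{2\pi}\,D_s(x) + O_s\!\left(x^{1-s}(\log x)^2\right), \end{multline*} and \begin{multline*} A^{(s)}(x;\phi_{s+a}) = \frac{\log\sqrt{2\pi}\,\zeta(1-a)}{\zeta(s+1)^2}\,x + \frac{s\,\zeta'(s+a+1)}{2(1+a)\zeta(s+a+1)^2}\,x^{1+a} + \frac{\log\sqrt{2\pi}}{1+a}\left(\frac{\zeta(1+a)}{\zeta(s+a+1)^2}-\frac{1}{\zeta(s+a+1)}\right)x^{1+a} \\ + \log\sqrt{2\pi}\sum_{d\leq x}\frac{(\mu*\mu)(d)}{d^s}\Delta_a\!\left(\frac{x}{d}\right) - \frac{\zeta(-a)}{2\zeta(s)^2}\log\sqrt{2\pi} - \frac{\zeta(-a)}{\zeta(s)}\left(\log\sqrt{2\pi}-\frac{s\,\zeta'(s)}{2\zeta(s)}\right)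 + O_{s,a}\!\left(x^{a}\right). \end{multline*}
   Context: $*$ denotes Dirichlet convolution, $\mu$ the Möbius function, $\Lambda$ the von Mangoldt function, $\zeta$ the Riemann zeta function, $\gamma$ Euler's constant, $\Gamma$ the Gamma function. For real $b$, $\mathrm{id}_b(n)=n^b$, and $\phi_b=\mathrm{id}_b*\mu$, i.e. $\phi_b(n)=\sum_{d\mid n}d^b\mu(n/d)$. For an integer $s\ge1$ and an arithmetic function $f$, define $$A^{(s)}(x;f)=\sum_{k\leq x}\frac{1}{k^s}\sum_{j=1}^{k^s}\log\Gamma\!\left(\frac{j}{k^s}\right)\sum_{\substack{d\mid k\\ d^s\mid j}}(f*\mu)(d).$$ Let $\vartheta(y)=y-\lfloor y\rfloor-\tfrac12$. Let $\tau(n)$ be the number of divisors of $n$ and define $\Delta(y)$ by $\sum_{n\le y}\tau(n)=y\log y+(2\gamma-1)y+\Delta(y)$. For $-1<a<0$ let $\sigma_a(n)=\sum_{d\mid n}d^a$ and define $\Delta_a(y)$ by $\sum_{n\le y}\sigma_a(n)=\zeta(1-a)y+\frac{\zeta(1+a)}{1+a}y^{1+a}-\frac{\zeta(-a)}{2}+\Delta_a(y)$. Finally $D_s(y)=-\sum_{d\le y}\frac{\mu(d)}{d^s}\vartheta\!\left(\frac{y}{d}\right)-\frac{1}{2\zeta(s)}$.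
   Formalization: In the first formula the O-constant is uniform for x ≥ x0, for each fixed x0 > 1, and may depend on x0; one constant for all x > 1 is impossible, since the error bound tends to 0 as x → 1+ while the difference does not (e.g. s = 2). *)

theory Defs
  imports
    "HOL-Complex_Analysis.Complex_Analysis"
    "HOL-Computational_Algebra.Squarefree"
    "HOL-Number_Theory.Prime_Powers"
begin

text \<open>
  Arithmetic functions are functions of type \<open>nat \<Rightarrow> real\<close>, of which only the values at
  positive arguments matter. The von Mangoldt function is \<^const>\<open>mangoldt\<close> from the library.
\<close>

definition dirichlet_conv :: "(nat \<Rightarrow> real) \<Rightarrow> (nat \<Rightarrow> real) \<Rightarrow> nat \<Rightarrow> real"
    (infixl \<open>\<star>\<close> 70) where
  "(f \<star> g) n = (\<Sum>d | d dvd n. f d * g (n div d))"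

definition moebius_mu :: "nat \<Rightarrow> real" where
  "moebius_mu n = (if squarefree n then (-1) ^ card (prime_factors n) else 0)"

definition id_pow :: "real \<Rightarrow> nat \<Rightarrow> real" where
  "id_pow b n = real n powr b"

definition phi :: "real \<Rightarrow> nat \<Rightarrow> real" where
  "phi b = id_pow b \<star> moebius_mu"

definition tau :: "nat \<Rightarrow> real" where
  "tau n = real (card {d. d dvd n})"

definition sigma :: "real \<Rightarrow> nat \<Rightarrow> real" where
  "sigma a n = (\<Sum>d | d dvd n. real d powr a)"

definition A :: "nat \<Rightarrow> real \<Rightarrow> (nat \<Rightarrow> real) \<Rightarrow> real" where
  "A s x f =
     (\<Sum>k = 1..nat \<lfloor>x\<rfloor>. 1 / real k ^ s *
        (\<Sum>j = 1..k ^ s. ln (Gamma (real j / real (k ^ s))) *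
           (\<Sum>d | d dvd k \<and> d ^ s dvd j. (f \<star> moebius_mu) d)))"

text \<open>
  The value at \<open>z \<noteq> 1\<close> is obtained by analytic continuation of the Dirichlet series from
  \<open>Re s > 1\<close> to a punctured half-plane \<open>Re s > c\<close> that contains \<open>z\<close>. These domains are
  connected and nested, so the value depends neither on \<open>c\<close> nor on \<open>f\<close>. The value at the
  pole \<open>1\<close> is meaningless.
\<close>

definition zeta :: "complex \<Rightarrow> complex" where
  "zeta z = (THE w. \<exists>f c. c < Re z \<and> f holomorphic_on {s. c < Re s} - {1} \<and>
     (\<forall>s. Re s > 1 \<longrightarrow> f s = (\<Sum>n. 1 / of_nat (Suc n) powr s)) \<and> w = f z)"

lemma zeta_eqI:
  assumes "c < Re z" "z \<noteq> 1"
    and hol: "f holomorphic_on {s. c < Re s} - {1}"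
    and ser: "\<And>s. Re s > 1 \<Longrightarrow> f s = (\<Sum>n. 1 / of_nat (Suc n) powr s)"
  shows "zeta z = f z"
  unfolding zeta_def
proof (rule the_equality)
  show "\<exists>f' c. c < Re z \<and> f' holomorphic_on {s. c < Re s} - {1} \<and>
     (\<forall>s. Re s > 1 \<longrightarrow> f' s = (\<Sum>n. 1 / of_nat (Suc n) powr s)) \<and> f z = f' z"
    using assms by blast
next
  fix w
  assume "\<exists>f c. c < Re z \<and> f holomorphic_on {s. c < Re s} - {1} \<and>
     (\<forall>s. Re s > 1 \<longrightarrow> f s = (\<Sum>n. 1 / of_nat (Suc n) powr s)) \<and> w = f z"
  then obtain g b where g: "b < Re z" "g holomorphic_on {s. b < Re s} - {1}"
     "\<And>s. Re s > 1 \<Longrightarrow> g s = (\<Sum>n. 1 / of_nat (Suc n) powr s)" "w = g z"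
    by blast
  define m where "m = max b c"
  define S where "S = {s. m < Re s} - {1::complex}"
  have S: "open S"
    unfolding S_def by (intro open_Diff open_halfspace_Re_gt) auto
  have conn: "connected S"
    unfolding S_def
    by (intro connected_open_delete open_halfspace_Re_gt convex_connected convex_halfspace_Re_gt) auto
  have hfS: "(\<lambda>s. g s - f s) holomorphic_on S"
    by (intro holomorphic_on_diff holomorphic_on_subset[OF g(2)] holomorphic_on_subset[OF hol])
       (auto simp: S_def m_def)
  define U where "U = {s::complex. max 1 m < Re s}"
  have U: "open U" "U \<subseteq> S"
    unfolding U_def by (rule open_halfspace_Re_gt) (auto simp: S_def)
  have xi: "of_real (max 1 m + 1) \<in> U"
    by (simp add: U_def max_def)
  have "g z - f z = 0"
    using hfS S conn
  proof (rule analytic_continuation[where U = U and \<xi> = "of_real (max 1 m + 1)"])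
    show "U \<subseteq> S" by fact
    show "of_real (max 1 m + 1) \<in> S" using xi U by blast
    show "of_real (max 1 m + 1) islimpt U"
      using U(1) xi by (simp add: interior_limit_point interior_open)
    show "g s - f s = 0" if "s \<in> U" for s
      using that g(3) ser by (simp add: U_def)
    show "z \<in> S"
      using assms(1,2) g(1) by (simp add: S_def m_def)
  qed
  thus "w = f z" using g(4) by simp
qed

text \<open>
  The continuation exists on \<open>Re s > 0\<close>, so there \<^const>\<open>zeta\<close> has the intended values.
\<close>

lemma zeta_term_bound:
  fixes s :: complex and n :: nat
  assumes s: "Re s > 0" "s \<noteq> 1"
  defines "m \<equiv> real (Suc n)"
  shows "norm (1 / of_nat (Suc n) powr s
            - (of_nat (n + 2) powr (1 - s) - of_nat (Suc n) powr (1 - s)) / (1 - s))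
         \<le> norm s * m powr (- Re s - 1)"
proof -
  define B where "B = norm s * m powr (- Re s - 1)"
  define S where "S = closed_segment (complex_of_real m) (complex_of_real (m + 1))"
  have m: "m > 0" by (simp add: m_def)
  have S_iff: "\<exists>r. u = of_real r \<and> m \<le> r \<and> r \<le> m + 1" if "u \<in> S" for u
    using that unfolding S_def closed_segment_of_real by (auto simp: closed_segment_eq_real_ivl)
  have S_mem: "complex_of_real m \<in> S" "complex_of_real (m + 1) \<in> S"
    by (simp_all add: S_def)
  have conv: "convex S" by (simp add: S_def)
  have 1: "norm (u powr (-s) - of_real m powr (-s)) \<le> B * norm (u - of_real m)" if "u \<in> S" for u
    using conv _ _ that S_mem(1)
  proof (rule field_differentiable_bound)
    fix z assume "z \<in> S"
    then obtain r where r: "z = of_real r" "m \<le> r" using S_iff by blast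
    show "((\<lambda>u. u powr (-s)) has_field_derivative (-s) * z powr (-s - 1)) (at z within S)"
      using r m by (intro has_field_derivative_powr has_field_derivative_at_within) auto
    have "r powr (- Re s - 1) \<le> m powr (- Re s - 1)"
      using r m s by (intro powr_mono2') auto
    thus "norm ((-s) * z powr (-s - 1)) \<le> B"
      using r m unfolding B_def by (simp add: norm_mult norm_powr_real_powr mult_left_mono)
  qed
  define H where "H = (\<lambda>u. u * of_real m powr (-s) - u powr (1 - s) / (1 - s))"
  have "norm (H (of_real (m + 1)) - H (of_real m)) \<le> B * norm (complex_of_real (m + 1) - of_real m)"
    using conv _ _ S_mem(2) S_mem(1)
  proof (rule field_differentiable_bound)
    fix z assume z: "z \<in> S"
    then obtain r where r: "z = of_real r" "m \<le> r" "r \<le> m + 1" using S_iff by blast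
    have "(H has_field_derivative (of_real m powr (-s) - ((1 - s) * z powr (1 - s - 1)) / (1 - s))) (at z)"
      using r m s unfolding H_def
      by (auto intro!: derivative_eq_intros has_field_derivative_powr)
    also have "((1 - s) * z powr (1 - s - 1)) / (1 - s) = z powr (-s)"
      using s by simp
    finally show "(H has_field_derivative (of_real m powr (-s) - z powr (-s))) (at z within S)"
      by (rule has_field_derivative_at_within)
    have "norm (z - of_real m) \<le> 1"
      using r by (simp flip: of_real_diff)
    hence "B * norm (z - of_real m) \<le> B * 1"
      by (intro mult_left_mono) (auto simp: B_def)
    thus "norm (of_real m powr (-s) - z powr (-s)) \<le> B"
      using 1[OF z] by (simp add: norm_minus_commute)
  qed
  also have "norm (complex_of_real (m + 1) - of_real m) = 1" by simp
  also have "H (of_real (m + 1)) - H (of_real m) =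
      1 / of_nat (Suc n) powr s - (of_nat (n + 2) powr (1 - s) - of_nat (Suc n) powr (1 - s)) / (1 - s)"
    by (simp add: H_def m_def powr_minus field_simps diff_divide_distrib add_divide_distrib)
  finally show ?thesis by (simp add: B_def)
qed

lemma zeta_continuation_exists:
  obtains f where "f holomorphic_on {s. 0 < Re s} - {1}"
    and "\<And>s. Re s > 1 \<Longrightarrow> f s = (\<Sum>n. 1 / of_nat (Suc n) powr s)"
proof -
  define S where "S = {s. 0 < Re s} - {1::complex}"
  define G where "G = (\<lambda>n s. 1 / of_nat (Suc n) powr s
      - (of_nat (n + 2) powr (1 - s) - of_nat (Suc n) powr (1 - s)) / (1 - s) :: complex)"
  have S: "open S"
    unfolding S_def by (intro open_Diff open_halfspace_Re_gt) auto
  obtain g where g: "\<forall>s\<in>S. (\<lambda>n. G n s) sums g s \<and> g field_differentiable (at s)"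
  proof (rule series_differentiable_comparison_complex[OF S])
    fix n s assume "s \<in> S"
    moreover have "of_nat (Suc k) \<noteq> (0 :: complex)" for k
      using of_nat_neq_0 .
    hence "G n holomorphic_on S"
      unfolding G_def S_def by (intro holomorphic_intros) (auto simp del: of_nat_Suc)
    ultimately show "G n field_differentiable (at s)"
      using S holomorphic_on_imp_differentiable_at by blast
  next
    fix s assume s: "s \<in> S"
    define d where "d = Re s / 2"
    define h where "h = (\<lambda>n. complex_of_real ((norm s + d) * real (Suc n) powr (- d - 1)))"
    have d: "d > 0" using s by (simp add: d_def S_def)
    have "summable (\<lambda>n. real n powr (- d - 1))"
      using d by (simp add: summable_real_powr_iff)
    hence "summable (\<lambda>n. real (Suc n) powr (- d - 1))"
      by (subst summable_Suc_iff)
    hence "summable h"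
      unfolding h_def by (intro summable_of_real summable_mult)
    moreover have "range h \<subseteq> \<real>\<^sub>\<ge>\<^sub>0"
      using d by (auto simp: h_def simp del: of_real_mult of_real_add)
    moreover have "norm (G n y) \<le> norm (h n)" if y: "y \<in> ball s d \<inter> S" for n y
    proof -
      have dist: "norm (s - y) < d" using y by (simp add: dist_norm)
      have "\<bar>Re (s - y)\<bar> < d" using dist abs_Re_le_cmod[of "s - y"] by linarith
      hence Re: "Re y > d" by (simp add: d_def abs_if split: if_splits)
      have ny: "norm y \<le> norm s + d"
        using dist norm_triangle_ineq2[of y s] by (simp add: norm_minus_commute)
      have "norm (G n y) \<le> norm y * real (Suc n) powr (- Re y - 1)"
        using zeta_term_bound[of y n] y unfolding G_def S_def by simp
      also have "\<dots> \<le> (norm s + d) * real (Suc n) powr (- d - 1)"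
        using Re ny d by (intro mult_mono powr_mono) auto
      also have "\<dots> = norm (h n)"
        using d unfolding h_def norm_of_real by (simp add: abs_mult)
      finally show ?thesis .
    qed
    ultimately show "\<exists>d h. 0 < d \<and> summable h \<and> range h \<subseteq> \<real>\<^sub>\<ge>\<^sub>0 \<and>
        (\<forall>\<^sub>F n in sequentially. \<forall>y\<in>ball s d \<inter> S. cmod (G n y) \<le> cmod (h n))"
      using d by (intro exI[of _ d] exI[of _ h] conjI always_eventually allI ballI)
  qed
  show ?thesis
  proof (rule that[of "\<lambda>s. 1 / (s - 1) + g s"])
    have "g holomorphic_on S"
      using g by (auto simp: holomorphic_on_def intro: field_differentiable_at_within)
    thus "(\<lambda>s. 1 / (s - 1) + g s) holomorphic_on {s. 0 < Re s} - {1}"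
      unfolding S_def by (auto intro!: holomorphic_intros)
  next
    fix s :: complex assume s: "Re s > 1"
    hence s': "s \<in> S" "s \<noteq> 1" by (auto simp: S_def)
    have "(\<lambda>n. real (Suc n) powr (1 - Re s)) \<longlonglongrightarrow> 0"
      using s by real_asymp
    moreover have "norm (of_nat (Suc n) powr (1 - s) :: complex) = real (Suc n) powr (1 - Re s)" for n
      by (subst norm_powr_real_powr) auto
    ultimately have "(\<lambda>n. norm (of_nat (Suc n) powr (1 - s) :: complex)) \<longlonglongrightarrow> 0"
      by simp
    hence "(\<lambda>n. of_nat (Suc n) powr (1 - s) :: complex) \<longlonglongrightarrow> 0"
      using tendsto_norm_zero_iff by blast
    from telescope_sums[OF this]
    have "(\<lambda>n. of_nat (n + 2) powr (1 - s) - of_nat (Suc n) powr (1 - s)) sums (- 1 :: complex)"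
      by simp
    from sums_add[OF conjunct1[OF bspec[OF g s'(1)]] sums_divide[OF this, of "1 - s"]]
    have "(\<lambda>n. 1 / of_nat (Suc n) powr s) sums (g s + (- 1) / (1 - s))"
      by (simp add: G_def)
    moreover have "(- 1) / (1 - s) = 1 / (s - 1)"
      using s'(2) by (simp add: field_simps)
    ultimately show "1 / (s - 1) + g s = (\<Sum>n. 1 / of_nat (Suc n) powr s)"
      by (simp add: sums_iff add.commute)
  qed
qed

abbreviation zeta_real :: "real \<Rightarrow> real" where
  "zeta_real x \<equiv> Re (zeta (complex_of_real x))"

abbreviation zeta_real' :: "real \<Rightarrow> real" where
  "zeta_real' x \<equiv> Re (deriv zeta (complex_of_real x))"

definition vartheta :: "real \<Rightarrow> real" where
  "vartheta y = y - of_int \<lfloor>y\<rfloor> - 1 / 2"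

definition Delta :: "real \<Rightarrow> real" where
  "Delta y = (\<Sum>n = 1..nat \<lfloor>y\<rfloor>. tau n) - (y * ln y + (2 * euler_mascheroni - 1) * y)"

definition Delta_sigma :: "real \<Rightarrow> real \<Rightarrow> real" where
  "Delta_sigma a y = (\<Sum>n = 1..nat \<lfloor>y\<rfloor>. sigma a n) -
     (zeta_real (1 - a) * y + zeta_real (1 + a) / (1 + a) * y powr (1 + a) - zeta_real (- a) / 2)"

definition D :: "nat \<Rightarrow> real \<Rightarrow> real" where
  "D s y = - (\<Sum>d = 1..nat \<lfloor>y\<rfloor>. moebius_mu d / real d ^ s * vartheta (y / real d))
           - 1 / (2 * zeta_real (real s))"

text \<open>
  On the error terms: \<open>x powr (1 - s) * (ln x)^2\<close> vanishes at \<open>x = 1\<close>, whereas the quantity it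
  bounds does not tend to \<open>0\<close> there in general. A bound for all \<open>x > 1\<close> with a single constant is
  therefore not available, and the constant is chosen for each half-line \<open>x \<ge> x\<^sub>0\<close> with
  \<open>x\<^sub>0 > 1\<close>; this contains the usual reading as \<open>x \<rightarrow> \<infinity>\<close>. For \<open>x powr a\<close> no such problem arises.
\<close>

end

theory Submission
  imports Defs "HOL-Computational_Algebra.Fundamental_Theorem_Algebra"
begin

text \<open>
  Gauss's multiplication formula turns the inner sum over \<open>j = d\<^sup>s m\<close> into
  \<open>((k/d)\<^sup>s - 1) log \<surd>(2\<pi>) - (s/2) log (k/d)\<close>, so \<open>A\<close> becomes a combination of summatory
  functions of Dirichlet convolutions. Since \<open>\<mu> * 1\<close> is the unit and \<open>\<mu> * log = \<Lambda>\<close>, for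
  \<open>f = id\<^bsub>s+a\<^esub> * \<mu>\<close> these are \<open>\<Sum>\<^bsub>d\<le>x\<^esub> c(d) d\<^bsup>-s\<^esup> H(x/d)\<close> with
  \<open>c \<in> {\<mu> * \<mu>, \<mu>, \<mu> * \<Lambda>}\<close> and \<open>H\<close> the summatory function of \<open>\<sigma>\<^sub>a\<close> or of \<open>n\<^sup>a\<close>.
  Inserting the expansion of \<open>H\<close> and completing the sums over \<open>d\<close> gives the main terms,
  because the Dirichlet series of \<open>c\<close> are \<open>1/\<zeta>\<^sup>2\<close>, \<open>1/\<zeta>\<close> and \<open>-\<zeta>'/\<zeta>\<^sup>2\<close>. The tails
  \<open>d > x\<close> are bounded by Rankin's trick: \<open>d\<^bsup>-s\<^esup> \<le> x\<^bsup>-r\<^esup> d\<^bsup>-(s-r)\<^esup>\<close> with \<open>s - r = s + a\<close> in the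
  second formula and \<open>s - r = 1 + 1/(2 + log x)\<close> in the first; the double pole of
  \<open>\<zeta>\<^sup>2\<close> at \<open>1\<close> produces the factor \<open>(log x)\<^sup>2\<close> there.
\<close>

subsection \<open>Gauss multiplication formula for Gamma\<close>

text \<open>Split the root 1 off \<open>X^N - 1\<close> and differentiate at 1: one side gives
  \<open>N\<close>, and on the other only the product over the nontrivial roots survives.\<close>

lemma prod_one_minus_roots_of_unity:
  assumes "N > 0"
  shows "(\<Prod>k = 1..<N. 1 - cis (2 * pi * real k / real N)) = of_nat N"
proof -
  define p where "p = (monom 1 N - 1 :: complex poly)"
  define w where "w k = cis (2 * pi * real k / real N)" for k
  have roots: "poly p z = 0 \<longleftrightarrow> z ^ N = 1" for z
    by (simp add: p_def poly_monom)
  have "degree p = N"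
    using assms degree_add_eq_left[of "- 1" "monom 1 N :: complex poly"]
    by (simp add: p_def degree_monom_eq)
  hence lead: "lead_coeff p = 1"
    using assms by (simp add: p_def)
  \<comment> \<open>The derivative \<open>N z^(N-1)\<close> can vanish only at 0, which is not a
    root of \<open>p\<close>.\<close>
  have "rsquarefree p"
    unfolding rsquarefree_roots using assms
    by (auto simp: roots) (auto simp: p_def pderiv_diff pderiv_monom poly_monom power_0_left)
  from complex_poly_decompose_rsquarefree[OF this]
  have "p = (\<Prod>z | z ^ N = 1. [:- z, 1:])"
    by (simp add: lead roots)
  also have "\<dots> = (\<Prod>k<N. [:- w k, 1:])"
    unfolding w_def by (rule prod.reindex_bij_betw[OF Complex.bij_betw_roots_unity[OF assms], symmetric])
  also have "{..<N} = insert 0 {1..<N}"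
    using assms by auto
  also have "(\<Prod>k\<in>insert 0 {1..<N}. [:- w k, 1:]) = [:- 1, 1:] * (\<Prod>k = 1..<N. [:- w k, 1:])"
    by (simp add: w_def)
  finally have p: "p = [:- 1, 1:] * (\<Prod>k = 1..<N. [:- w k, 1:])" .
  have "poly (pderiv p) 1 = of_nat N"
    by (simp add: p_def pderiv_diff pderiv_monom poly_monom)
  moreover have "poly (pderiv p) 1 = (\<Prod>k = 1..<N. 1 - w k)"
    unfolding p pderiv_mult by (simp add: pderiv_pCons poly_prod)
  ultimately show ?thesis
    by (simp add: w_def)
qed

text \<open>The squared modulus is \<open>2 - 2 cos t = 4 sin(t/2)^2\<close>.\<close>

lemma norm_one_minus_cis: "norm (1 - cis t) = 2 * \<bar>sin (t / 2)\<bar>"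
proof -
  have "cos t = 1 - 2 * sin (t / 2) ^ 2"
    using cos_double_sin[of "t / 2"] by simp
  hence "norm (1 - cis t) ^ 2 = (2 * \<bar>sin (t / 2)\<bar>) ^ 2"
    using sin_cos_squared_add[of t]
    by (simp add: cmod_power2 power2_diff power_mult_distrib)
  thus ?thesis
    by (rule power2_eq_imp_eq) auto
qed

lemma prod_sin_pi_fractions:
  assumes "N > 0"
  shows "(\<Prod>k = 1..<N. 2 * sin (pi * (real k / real N))) = real N"
proof -
  have "(\<Prod>k = 1..<N. 2 * sin (pi * (real k / real N)))
      = (\<Prod>k = 1..<N. norm (1 - cis (2 * pi * real k / real N)))"
  proof (rule prod.cong)
    fix k assume "k \<in> {1..<N}"
    hence "sin (pi * (real k / real N)) > 0"
      by (intro sin_gt_zero) (auto simp: field_simps)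
    thus "2 * sin (pi * (real k / real N)) = norm (1 - cis (2 * pi * real k / real N))"
      by (simp add: norm_one_minus_cis)
  qed simp
  also have "\<dots> = norm (\<Prod>k = 1..<N. 1 - cis (2 * pi * real k / real N))"
    by (simp add: prod_norm)
  also have "\<dots> = real N"
    by (simp only: prod_one_minus_roots_of_unity[OF assms] norm_of_nat)
  finally show ?thesis .
qed

text \<open>The complex reflection formula restricted to the real line. At an integer one of the two
  Gamma values is at a pole and hence 0 by convention, and so is the quotient by
  \<open>sin (pi * x) = 0\<close>.\<close>

lemma Gamma_reflection_real: "Gamma x * Gamma (1 - x :: real) = pi / sin (pi * x)"
proof -
  have "complex_of_real (Gamma x * Gamma (1 - x)) = Gamma (of_real x) * Gamma (of_real (1 - x))"
    by (simp only: of_real_mult Gamma_complex_of_real)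
  also have "\<dots> = of_real pi / sin (of_real pi * of_real x)"
    using Gamma_reflection_complex[of "of_real x"] by simp
  also have "\<dots> = of_real (pi / sin (pi * x))"
    by (simp only: of_real_mult[symmetric] of_real_divide sin_of_real)
  finally show ?thesis
    by (simp only: of_real_eq_iff)
qed

text \<open>Logarithmic form of Gauss's multiplication formula at one point: pairing
  \<open>k\<close> with \<open>N - k\<close> and applying the reflection formula leaves only the
  sine product, which equals \<open>N\<close>.\<close>

lemma sum_ln_Gamma_fractions:
  assumes "N > 0"
  shows "(\<Sum>k = 1..N. ln (Gamma (real k / real N))) =
           (real N - 1) * ln (sqrt (2 * pi)) - ln (real N) / 2"
proof -
  define S where "S = (\<Sum>k = 1..<N. ln (Gamma (real k / real N)))"
  have "S = (\<Sum>k = 1..<N. ln (Gamma (real (N - k) / real N)))"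
    unfolding S_def
    by (rule sum.reindex_bij_witness[where i = "\<lambda>k. N - k" and j = "\<lambda>k. N - k"]) auto
  also have "\<dots> = (\<Sum>k = 1..<N. ln (Gamma (1 - real k / real N)))"
    using assms by (intro sum.cong) (auto simp: of_nat_diff diff_divide_distrib)
  finally have "2 * S = (\<Sum>k = 1..<N. ln (Gamma (real k / real N)) + ln (Gamma (1 - real k / real N)))"
    by (simp add: sum.distrib S_def)
  also have "\<dots> = (\<Sum>k = 1..<N. ln (2 * pi) - ln (2 * sin (pi * (real k / real N))))"
  proof (rule sum.cong)
    fix k assume k: "k \<in> {1..<N}"
    define x where "x = real k / real N"
    have x: "0 < x" "x < 1"
      using k by (auto simp: x_def field_simps)
    hence "pi * x < pi"
      by simp
    hence s: "sin (pi * x) > 0"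
      using x by (intro sin_gt_zero) auto
    have "ln (Gamma x) + ln (Gamma (1 - x)) = ln (Gamma x * Gamma (1 - x))"
      using x by (intro ln_mult_pos[symmetric] Gamma_real_pos) auto
    also have "\<dots> = ln ((2 * pi) / (2 * sin (pi * x)))"
      by (simp add: Gamma_reflection_real)
    also have "\<dots> = ln (2 * pi) - ln (2 * sin (pi * x))"
      using s by (intro ln_divide_pos) auto
    finally show "ln (Gamma (real k / real N)) + ln (Gamma (1 - real k / real N)) =
        ln (2 * pi) - ln (2 * sin (pi * (real k / real N)))"
      by (simp add: x_def)
  qed simp
  also have "\<dots> = (real N - 1) * ln (2 * pi) - (\<Sum>k = 1..<N. ln (2 * sin (pi * (real k / real N))))"
    using assms by (simp add: sum_subtractf of_nat_diff)
  also have "(\<Sum>k = 1..<N. ln (2 * sin (pi * (real k / real N)))) =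
      ln (\<Prod>k = 1..<N. 2 * sin (pi * (real k / real N)))"
  proof (intro ln_prod[symmetric] finite_atLeastLessThan)
    fix k assume "k \<in> {1..<N}"
    hence "sin (pi * (real k / real N)) > 0"
      by (intro sin_gt_zero) (auto simp: field_simps)
    thus "2 * sin (pi * (real k / real N)) \<noteq> 0"
      by simp
  qed
  also have "\<dots> = ln (real N)"
    using assms by (simp only: prod_sin_pi_fractions)
  finally have "S = (real N - 1) * ln (sqrt (2 * pi)) - ln (real N) / 2"
    by (simp add: ln_sqrt field_simps)
  \<comment> \<open>The term \<open>k = N\<close> is \<open>ln (Gamma 1) = 0\<close>, so
    \<open>S\<close> is already the full sum.\<close>
  moreover have "{1..N} = insert N {1..<N}"
    using assms by auto
  ultimately show ?thesis
    using assms by (simp add: S_def)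
qed

subsection \<open>Dirichlet convolution\<close>

text \<open>Every number divides 0, and a sum over an infinite set is 0 by convention. This lets the
  algebraic laws below be equations between functions.\<close>

lemma dirichlet_conv_0 [simp]: "(f \<star> g) 0 = 0"
  by (simp add: dirichlet_conv_def)

lemma dirichlet_conv_pairs:
  assumes "n > 0"
  shows "(f \<star> g) n = (\<Sum>(a, b) | a * b = n. f a * g b)"
  unfolding dirichlet_conv_def
  by (rule sum.reindex_bij_witness[where i = fst and j = "\<lambda>d. (d, n div d)"])
     (use assms in auto)

lemma dirichlet_conv_commute: "f \<star> g = g \<star> f"
proof
  fix n
  show "(f \<star> g) n = (g \<star> f) n"
  proof (cases "n = 0")
    case False
    have "(\<Sum>(a, b) | a * b = n. f a * g b) = (\<Sum>(a, b) | a * b = n. g a * f b)"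
      by (rule sum.reindex_bij_witness[where i = prod.swap and j = prod.swap])
         (auto simp: mult.commute)
    thus ?thesis
      using False by (simp add: dirichlet_conv_pairs)
  qed simp
qed

lemma finite_factorisations: "n > 0 \<Longrightarrow> finite {(a, b). a * b = (n::nat)}"
  by (rule finite_subset[of _ "{..n} \<times> {..n}"]) auto

lemma dirichlet_conv_assoc: "(f \<star> g) \<star> h = f \<star> (g \<star> h)"
proof
  fix n
  show "((f \<star> g) \<star> h) n = (f \<star> (g \<star> h)) n"
  proof (cases "n = 0")
    case False
    define P where "P m = {(a, b). a * b = (m::nat)}" for m
    have fin: "finite (P m)" if "m > 0" for m
      unfolding P_def using that by (rule finite_factorisations)
    have "((f \<star> g) \<star> h) n = (\<Sum>x\<in>P n. \<Sum>y\<in>P (fst x). f (fst y) * g (snd y) * h (snd x))"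
      using False
      by (auto simp: dirichlet_conv_pairs P_def case_prod_unfold sum_distrib_right intro!: sum.cong)
    also have "\<dots> = (\<Sum>(x, y)\<in>(SIGMA x:P n. P (fst x)). f (fst y) * g (snd y) * h (snd x))"
      using False by (intro sum.Sigma ballI fin) (auto simp: P_def)
    \<comment> \<open>Both index sets are the triples with product \<open>n\<close>, bracketed to
      the left and to the right.\<close>
    also have "\<dots> = (\<Sum>(x, y)\<in>(SIGMA x:P n. P (snd x)). f (fst x) * (g (fst y) * h (snd y)))"
      by (rule sum.reindex_bij_witness[where
            j = "\<lambda>((ab, c), (a, b)). ((a, b * c), (b, c))" and
            i = "\<lambda>((a, bc), (b, c)). ((a * b, c), (a, b))"])
         (auto simp: P_def)
    also have "\<dots> = (\<Sum>x\<in>P n. \<Sum>y\<in>P (snd x). f (fst x) * (g (fst y) * h (snd y)))"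
      using False by (intro sum.Sigma[symmetric] ballI fin) (auto simp: P_def)
    also have "\<dots> = (f \<star> (g \<star> h)) n"
      using False
      by (auto simp: dirichlet_conv_pairs P_def case_prod_unfold sum_distrib_left intro!: sum.cong)
    finally show ?thesis .
  qed simp
qed

lemma dirichlet_conv_left_commute: "f \<star> (g \<star> h) = g \<star> (f \<star> h)"
  by (metis dirichlet_conv_assoc dirichlet_conv_commute)

lemmas dirichlet_conv_ac = dirichlet_conv_assoc dirichlet_conv_commute dirichlet_conv_left_commute

text \<open>As \<open>n powr t\<close> is completely multiplicative, twisting by it is a
  homomorphism for convolution.\<close>

lemma dirichlet_conv_powr:
  "(f \<star> g) n * real n powr t = ((\<lambda>n. f n * real n powr t) \<star> (\<lambda>n. g n * real n powr t)) n"
proof (cases "n = 0")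
  case False
  thus ?thesis
    by (auto simp: dirichlet_conv_pairs sum_distrib_right powr_mult intro!: sum.cong)
qed simp

text \<open>Additivity of the logarithm on products makes multiplication by it a derivation of the
  convolution algebra.\<close>

lemma dirichlet_conv_ln:
  "(f \<star> g) n * ln (real n) =
     ((\<lambda>n. f n * ln (real n)) \<star> g) n + (f \<star> (\<lambda>n. g n * ln (real n))) n"
proof (cases "n = 0")
  case False
  have "(\<Sum>(a, b) | a * b = n. f a * g b) * ln (real n) =
        (\<Sum>(a, b) | a * b = n. f a * ln (real a) * g b + f a * (g b * ln (real b)))"
    unfolding sum_distrib_right
  proof (rule sum.cong)
    fix x assume "x \<in> {(a, b). a * b = n}"
    moreover from this have "fst x > 0" "snd x > 0"
      using False by (auto intro!: gr0I)
    ultimately show "(case x of (a, b) \<Rightarrow> f a * g b) * ln (real n) =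
        (case x of (a, b) \<Rightarrow> f a * ln (real a) * g b + f a * (g b * ln (real b)))"
      by (auto simp: ln_mult algebra_simps)
  qed simp
  thus ?thesis
    using False by (simp add: dirichlet_conv_pairs sum.distrib case_prod_unfold)
qed simp

text \<open>The sum runs over lattice points under the hyperbola \<open>d * n \<le> x\<close>; they
  are grouped by \<open>d\<close>.\<close>

lemma sum_dirichlet_conv:
  "(\<Sum>k = 1..nat \<lfloor>x\<rfloor>. (f \<star> g) k) =
     (\<Sum>d = 1..nat \<lfloor>x\<rfloor>. f d * (\<Sum>n = 1..nat \<lfloor>x / real d\<rfloor>. g n))"
proof -
  define N where "N = nat \<lfloor>x\<rfloor>"
  \<comment> \<open>Nested floors collapse, so the count takes place in natural number division. For
    \<open>d = 0\<close> both sides are 0.\<close>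
  have div: "nat \<lfloor>x / real d\<rfloor> = N div d" for d
  proof (cases "x \<ge> 0")
    case True
    thus ?thesis
      using floor_divide_real_eq_div[of "int d" x] by (simp add: N_def nat_div_distrib)
  next
    case False
    hence "x / real d \<le> 0" by (simp add: divide_nonpos_nonneg)
    hence "\<lfloor>x / real d\<rfloor> \<le> 0" by (simp add: floor_le_iff)
    thus ?thesis using False by (simp add: N_def)
  qed
  have fin: "finite {(a, b). a * b = k}" if "k \<in> {1..N}" for k
    using that by (intro finite_factorisations) auto
  have "(\<Sum>k = 1..N. (f \<star> g) k) = (\<Sum>k = 1..N. \<Sum>y | fst y * snd y = k. f (fst y) * g (snd y))"
    by (intro sum.cong) (auto simp: dirichlet_conv_pairs case_prod_unfold)
  also have "\<dots> = (\<Sum>(k, y)\<in>(SIGMA k:{1..N}. {y. fst y * snd y = k}). f (fst y) * g (snd y))"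
    using fin by (intro sum.Sigma) (auto simp: case_prod_unfold)
  also have "\<dots> = (\<Sum>(d, n)\<in>(SIGMA d:{1..N}. {1..N div d}). f d * g n)"
  proof (rule sum.reindex_bij_witness[where j = snd and i = "\<lambda>(d, n). (d * n, (d, n))"])
    fix z assume "z \<in> (SIGMA k:{1..N}. {y. fst y * snd y = k})"
    then obtain a b where z: "z = (a * b, (a, b))" "a * b > 0" "a * b \<le> N"
      by (cases z) auto
    hence ab: "a > 0" "b > 0" by auto
    hence "b \<le> N div a" "a \<le> N"
      using z(3) by (auto simp: less_eq_div_iff_mult_less_eq mult.commute intro: order.trans[OF _ z(3)])
    thus "snd z \<in> (SIGMA d:{1..N}. {1..N div d})"
      using z ab by auto
  next
    fix z assume "z \<in> (SIGMA d:{1..N}. {1..N div d})"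
    then obtain d n where z: "z = (d, n)" "d > 0" "n > 0" "n \<le> N div d" by (cases z) auto
    hence "d * n \<le> N" by (simp add: less_eq_div_iff_mult_less_eq mult.commute)
    thus "(case z of (d, n) \<Rightarrow> (d * n, d, n)) \<in> (SIGMA k:{1..N}. {y. fst y * snd y = k})"
      using z by auto
  qed auto
  also have "\<dots> = (\<Sum>d = 1..N. \<Sum>n = 1..N div d. f d * g n)"
    by (rule sum.Sigma[symmetric]) auto
  finally show ?thesis
    by (simp add: div sum_distrib_left flip: N_def)
qed

section \<open>The convolution unit, the Moebius function and the von Mangoldt function\<close>

definition dirichlet_unit :: "nat \<Rightarrow> real" where
  "dirichlet_unit n = (if n = 1 then 1 else 0)"

text \<open>Only \<open>d = n\<close> has cofactor 1. At 0 the left side is 0 whatever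
  \<open>f 0\<close> is, hence the restriction to positive \<open>n\<close>.\<close>

lemma dirichlet_conv_unit_right: "n > 0 \<Longrightarrow> (f \<star> dirichlet_unit) n = f n"
proof -
  assume n: "n > 0"
  have "(f \<star> dirichlet_unit) n = (\<Sum>d\<in>{n}. f d * dirichlet_unit (n div d))"
    unfolding dirichlet_conv_def
  proof (rule sum.mono_neutral_right)
    show "\<forall>d\<in>{d. d dvd n} - {n}. f d * dirichlet_unit (n div d) = 0"
    proof
      fix d assume d: "d \<in> {d. d dvd n} - {n}"
      hence "d * (n div d) = n" by simp
      hence "n div d \<noteq> 1" using d by (metis DiffD2 mult.right_neutral singletonI)
      thus "f d * dirichlet_unit (n div d) = 0"
        by (simp add: dirichlet_unit_def)
    qed
  qed (use n in auto)
  thus ?thesis using n by (simp add: dirichlet_unit_def)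
qed

text \<open>A new prime preserves squarefreeness and adds one prime factor, which flips the
  sign.\<close>

lemma moebius_mu_prime_mult:
  assumes "prime p" "\<not> p dvd n"
  shows "moebius_mu (p * n) = - moebius_mu n"
proof -
  have cop: "coprime p n"
    using assms by (simp add: prime_imp_coprime)
  have "n \<noteq> 0" using assms by (intro notI) auto
  moreover have "p \<notin> prime_factors n"
    using assms by (auto simp: prime_factors_dvd)
  moreover have "prime_factors (p * n) = insert p (prime_factors n)"
    using assms \<open>n \<noteq> 0\<close> by (subst prime_factors_product) (auto simp: prime_prime_factors)
  moreover have "squarefree (p * n) \<longleftrightarrow> squarefree n"
    using cop assms by (auto simp: squarefree_prime intro: squarefree_mult_coprime dest: squarefree_multD(2))
  ultimately show ?thesis
    by (simp add: moebius_mu_def)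
qed

text \<open>For a prime \<open>p\<close> dividing \<open>n\<close>, multiplication by
  \<open>p\<close> is a sign-reversing bijection from the squarefree divisors prime to
  \<open>p\<close> onto those divisible by \<open>p\<close>, so the sum cancels.\<close>

lemma moebius_mu_conv_one: "moebius_mu \<star> (\<lambda>_. 1) = dirichlet_unit"
proof
  fix n :: nat
  consider "n = 0" | "n = 1" | "n > 1"
    by linarith
  thus "(moebius_mu \<star> (\<lambda>_. 1)) n = dirichlet_unit n"
  proof cases
    case 3
    then obtain p where p: "prime p" "p dvd n"
      using prime_factor_nat[of n] by auto
    define U where "U = {d. d dvd n \<and> squarefree d}"
    have fin: "finite U"
      using 3 unfolding U_def by (intro finite_subset[OF _ finite_divisors_nat[of n]]) auto
    have "(\<Sum>d | d dvd n. moebius_mu d) = (\<Sum>d\<in>U. moebius_mu d)"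
      using 3 by (intro sum.mono_neutral_right) (auto simp: U_def moebius_mu_def)
    also have "U = {d \<in> U. \<not> p dvd d} \<union> {d \<in> U. p dvd d}"
      by auto
    also have "(\<Sum>d\<in>\<dots>. moebius_mu d) =
        (\<Sum>d\<in>{d \<in> U. \<not> p dvd d}. moebius_mu d) + (\<Sum>d\<in>{d \<in> U. p dvd d}. moebius_mu d)"
      using fin by (intro sum.union_disjoint) auto
    also have "(\<Sum>d\<in>{d \<in> U. p dvd d}. moebius_mu d) = (\<Sum>d\<in>{d \<in> U. \<not> p dvd d}. - moebius_mu d)"
    proof (rule sum.reindex_bij_witness[where i = "\<lambda>d. p * d" and j = "\<lambda>d. d div p"])
      fix d assume d: "d \<in> {d \<in> U. p dvd d}"
      then obtain e where e: "d = p * e" by auto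
      have "\<not> p dvd e"
      proof
        assume "p dvd e"
        hence "p ^ 2 dvd d" by (simp add: e power2_eq_square)
        thus False using d p(1) by (auto simp: U_def squarefree_def)
      qed
      moreover have "squarefree e" "e dvd n"
        using d e by (auto simp: U_def dest: squarefree_multD(2) intro: dvd_mult_right)
      ultimately show "p * (d div p) = d" "d div p \<in> {d \<in> U. \<not> p dvd d}"
          "- moebius_mu (d div p) = moebius_mu d"
        using p(1) moebius_mu_prime_mult[of p e] by (auto simp: e U_def)
    next
      fix d assume d: "d \<in> {d \<in> U. \<not> p dvd d}"
      hence "coprime p d" using p(1) by (simp add: prime_imp_coprime)
      thus "p * d div p = d" "p * d \<in> {d \<in> U. p dvd d}"
        using d p by (auto simp: U_def squarefree_prime intro!: divides_mult squarefree_mult_coprime)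
    qed
    finally show ?thesis
      using 3 by (simp add: dirichlet_conv_def dirichlet_unit_def sum_negf)
  qed (auto simp: dirichlet_conv_def dirichlet_unit_def moebius_mu_def)
qed

lemma mangoldt_conv_one: "mangoldt \<star> (\<lambda>_. 1) = (\<lambda>n. ln (real n))"
proof
  fix n show "(mangoldt \<star> (\<lambda>_. 1)) n = ln (real n)"
    using mangoldt_sum[of n, where ?'a = real] by (cases "n = 0") (auto simp: dirichlet_conv_def)
qed

subsection \<open>Dirichlet series\<close>

text \<open>Unordered summation, which for real terms means absolute convergence, is what allows
  rearrangement by products. The relation states convergence and value at once.\<close>

definition has_dseries :: "(nat \<Rightarrow> real) \<Rightarrow> real \<Rightarrow> real \<Rightarrow> bool" where
  "has_dseries c t S \<longleftrightarrow> ((\<lambda>n. c n * real n powr - t) has_sum S) {1..}"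

lemma has_dseries_unique: "has_dseries c t S \<Longrightarrow> has_dseries c t T \<Longrightarrow> S = T"
  unfolding has_dseries_def by (rule has_sum_unique)

lemma has_dseries_add:
  "has_dseries f t S \<Longrightarrow> has_dseries g t T \<Longrightarrow> has_dseries (\<lambda>n. f n + g n) t (S + T)"
  unfolding has_dseries_def by (simp add: distrib_right has_sum_add)

lemma has_dseries_cmult: "has_dseries f t S \<Longrightarrow> has_dseries (\<lambda>n. k * f n) t (k * S)"
  unfolding has_dseries_def by (simp add: mult.assoc has_sum_cmult_right)

lemma has_dseries_cong:
  assumes "\<And>n. n > 0 \<Longrightarrow> f n = g n"
  shows "has_dseries f t S \<longleftrightarrow> has_dseries g t S"
  unfolding has_dseries_def by (intro has_sum_cong) (use assms in auto)

lemma has_dseries_mono: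
  assumes "has_dseries f t S" "has_dseries g t' T"
    and "\<And>n. n > 0 \<Longrightarrow> f n * real n powr - t \<le> g n * real n powr - t'"
  shows "S \<le> T"
  using assms(1,2) unfolding has_dseries_def
  by (rule has_sum_mono) (use assms(3) in auto)

lemma has_dseries_nonneg: "has_dseries c t S \<Longrightarrow> (\<And>n. n > 0 \<Longrightarrow> c n \<ge> 0) \<Longrightarrow> S \<ge> 0"
  unfolding has_dseries_def by (rule has_sum_nonneg) auto

text \<open>The two exponents may differ, so that a factor such as \<open>ln (real n)\<close> can be
  traded for a small power of \<open>n\<close>.\<close>

lemma has_dseries_comparison:
  assumes "has_dseries g t' B"
    and "\<And>n. n > 0 \<Longrightarrow> \<bar>f n * real n powr - t\<bar> \<le> g n * real n powr - t'"
  obtains S where "has_dseries f t S" "\<bar>S\<bar> \<le> B"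
proof -
  have "(\<lambda>n. norm (f n * real n powr - t)) summable_on {1..}"
  proof (rule Infinite_Sum.abs_summable_on_comparison_test')
    show "(\<lambda>n. g n * real n powr - t') summable_on {1..}"
      using assms(1) unfolding has_dseries_def by (rule has_sum_imp_summable)
  qed (use assms(2) in auto)
  hence "(\<lambda>n. f n * real n powr - t) summable_on {1..}"
    by (rule summable_on_iff_abs_summable_on_real[THEN iffD2])
  then obtain S where S: "has_dseries f t S"
    unfolding has_dseries_def summable_on_def by blast
  have "S \<le> B" "- S \<le> B"
    using has_dseries_mono[OF S assms(1)] has_dseries_mono[OF has_dseries_cmult[OF S, of "-1"] assms(1)]
      assms(2) by (force simp: abs_le_iff)+
  thus ?thesis
    using S that by fastforce
qed

lemma has_dseries_comparison':
  assumes "has_dseries g t B" and "\<And>n. n > 0 \<Longrightarrow> \<bar>f n\<bar> \<le> g n"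
  obtains S where "has_dseries f t S" "\<bar>S\<bar> \<le> B"
  by (rule has_dseries_comparison[OF assms(1), of f t])
     (use assms(2) in \<open>auto simp: abs_mult intro!: mult_right_mono\<close>)

text \<open>The product family is absolutely summable over all pairs; summing it by rows gives
  \<open>S * T\<close>, and summing it along the fibres of \<open>(a, b) \<mapsto> a * b\<close>
  gives the convolution.\<close>

lemma has_sum_dirichlet_conv:
  assumes F: "(F has_sum S) {1..}" and G: "(G has_sum T) {1..}"
  shows "((F \<star> G) has_sum S * T) {1..}"
proof -
  define h where "h = (\<lambda>(a, b). F a * G b)"
  define P where "P n = {(a, b). a * b = (n::nat)}" for n
  have "(\<lambda>a. \<bar>F a\<bar>) summable_on {1..}" "(\<lambda>b. \<bar>G b\<bar>) summable_on {1..}"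
    using F[THEN has_sum_imp_summable] G[THEN has_sum_imp_summable]
    unfolding summable_on_iff_abs_summable_on_real[of F] summable_on_iff_abs_summable_on_real[of G]
    by simp_all
  then obtain S' T' where abs: "((\<lambda>a. \<bar>F a\<bar>) has_sum S') {1..}" "((\<lambda>b. \<bar>G b\<bar>) has_sum T') {1..}"
    unfolding summable_on_def by blast
  have "(\<lambda>(a, b). \<bar>F a\<bar> * \<bar>G b\<bar>) summable_on {1..} \<times> {1..}"
  proof (rule summable_on_SigmaI)
    show "((\<lambda>b. case (a, b) of (a, b) \<Rightarrow> \<bar>F a\<bar> * \<bar>G b\<bar>) has_sum \<bar>F a\<bar> * T') {1..}" for a
      using has_sum_cmult_right[OF abs(2), of "\<bar>F a\<bar>"] by simp
    show "(\<lambda>a. \<bar>F a\<bar> * T') summable_on {1..}"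
      using has_sum_cmult_left[OF abs(1)] by (rule has_sum_imp_summable)
  qed auto
  hence "h summable_on {1..} \<times> {1..}"
    by (subst summable_on_iff_abs_summable_on_real) (simp add: h_def case_prod_unfold abs_mult)
  with has_sum_cmult_right[OF G] has_sum_cmult_left[OF F, of T]
  have "(h has_sum S * T) ({1..} \<times> {1..})"
    by (intro has_sum_SigmaI[where g = "\<lambda>a. F a * T"]) (simp_all add: h_def)
  \<comment> \<open>Each pair is tagged with its product, which exhibits the quadrant as a union of
    finite fibres.\<close>
  also have "?this \<longleftrightarrow> ((\<lambda>x. h (snd x)) has_sum S * T) (Sigma {1..} P)"
    by (rule has_sum_reindex_bij_witness[where i = snd and j = "\<lambda>(a, b). (a * b, (a, b))"])
       (auto simp: P_def intro!: Suc_leI)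
  finally have "((\<lambda>x. h (snd x)) has_sum S * T) (Sigma {1..} P)" .
  moreover have "((\<lambda>y. h (snd (n, y))) has_sum (F \<star> G) n) (P n)" if "n \<in> {1..}" for n
    using that finite_factorisations[of n]
    by (auto simp: dirichlet_conv_pairs P_def h_def intro!: has_sum_finiteI)
  ultimately show ?thesis
    by (rule has_sum_SigmaD)
qed

lemma has_dseries_dirichlet_conv:
  assumes "has_dseries f t S" "has_dseries g t T"
  shows "has_dseries (f \<star> g) t (S * T)"
  using has_sum_dirichlet_conv[OF assms[unfolded has_dseries_def]]
  unfolding has_dseries_def dirichlet_conv_powr .

lemma abs_dirichlet_conv_le:
  assumes "\<And>n. n > 0 \<Longrightarrow> \<bar>f n\<bar> \<le> f' n" "\<And>n. n > 0 \<Longrightarrow> \<bar>g n\<bar> \<le> g' n"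
  shows "\<bar>(f \<star> g) n\<bar> \<le> (f' \<star> g') n"
proof (cases "n = 0")
  case False
  have "\<bar>(f \<star> g) n\<bar> \<le> (\<Sum>d | d dvd n. \<bar>f d * g (n div d)\<bar>)"
    unfolding dirichlet_conv_def by (rule sum_abs)
  also have "\<dots> \<le> (\<Sum>d | d dvd n. f' d * g' (n div d))"
  proof (rule sum_mono)
    fix d assume "d \<in> {d. d dvd n}"
    hence "d > 0" "n div d > 0"
      using False by (auto intro: Nat.gr0I dvd_pos_nat)
    hence "\<bar>f d\<bar> \<le> f' d" "\<bar>g (n div d)\<bar> \<le> g' (n div d)"
      using assms by auto
    thus "\<bar>f d * g (n div d)\<bar> \<le> f' d * g' (n div d)"
      unfolding abs_mult by (intro mult_mono) auto
  qed
  finally show ?thesis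
    by (simp add: dirichlet_conv_def)
qed simp

text \<open>Rankin's trick: for \<open>n > x\<close> the bound on \<open>w\<close> turns the term
  into at most \<open>W * x powr - r\<close> times
  \<open>\<bar>c n\<bar> * real n powr - (t - r)\<close>, and the tail of this nonnegative series is
  at most its full sum \<open>B\<close>.\<close>

lemma dseries_truncation:
  assumes x: "x \<ge> 1" and W: "W \<ge> 0"
    and B: "has_dseries (\<lambda>n. \<bar>c n\<bar>) (t - r) B"
    and w: "\<And>n. real n > x \<Longrightarrow> \<bar>w n\<bar> \<le> W * (real n / x) powr r"
    and T: "has_dseries (\<lambda>n. c n * w n) t T"
  shows "\<bar>(\<Sum>n = 1..nat \<lfloor>x\<rfloor>. c n * w n * real n powr - t) - T\<bar> \<le> W * x powr - r * B"
proof -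
  define N where "N = nat \<lfloor>x\<rfloor>"
  define u where "u n = c n * w n * real n powr - t" for n
  define v where "v n = W * x powr - r * (\<bar>c n\<bar> * real n powr - (t - r))" for n
  have big: "real n > x" if "n \<in> {1..} - {1..N}" for n
    using that x unfolding N_def by (auto simp: not_le nat_less_iff floor_less_iff)
  \<comment> \<open>What remains after removing the terms up to \<open>N\<close> is the tail, so its
    value is the negated truncation error.\<close>
  have u: "(u has_sum (T - sum u {1..N})) ({1..} - {1..N})"
    using T unfolding has_dseries_def u_def
    by (intro has_sum_Diff) auto
  have v: "(v has_sum W * x powr - r * B) {1..}"
    using B unfolding has_dseries_def v_def by (rule has_sum_cmult_right)
  have "v summable_on ({1..} - {1..N})"
    using has_sum_imp_summable[OF v] by (rule summable_on_subset) auto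
  then obtain V where V: "(v has_sum V) ({1..} - {1..N})"
    unfolding summable_on_def by blast
  have "V \<le> W * x powr - r * B"
    using V v by (rule has_sum_mono2) (use W in \<open>auto simp: v_def\<close>)
  have uv: "\<bar>u n\<bar> \<le> v n" if "n \<in> {1..} - {1..N}" for n
  proof -
    have n: "real n > x" using big that by blast
    have "\<bar>u n\<bar> = \<bar>c n\<bar> * real n powr - t * \<bar>w n\<bar>"
      by (simp add: u_def abs_mult)
    also have "\<dots> \<le> \<bar>c n\<bar> * real n powr - t * (W * (real n / x) powr r)"
      using w[OF n] by (intro mult_left_mono) auto
    also have "\<dots> = v n"
      using x n by (simp add: v_def powr_divide powr_minus powr_diff field_simps)
    finally show ?thesis .
  qed
  have "T - sum u {1..N} \<le> V"
    using u V by (rule has_sum_mono) (use uv in \<open>auto simp: abs_le_iff\<close>)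
  moreover have "- (T - sum u {1..N}) \<le> V"
    using has_sum_uminusI[OF u] V by (rule has_sum_mono) (use uv in \<open>auto simp: abs_le_iff\<close>)
  ultimately show ?thesis
    using \<open>V \<le> W * x powr - r * B\<close> by (simp add: u_def N_def)
qed

subsection \<open>Values of the zeta function\<close>

lemma zeta_eq_suminf:
  assumes "Re z > 1"
  shows "zeta z = (\<Sum>n. 1 / of_nat (Suc n) powr z)"
proof -
  obtain f where f: "f holomorphic_on {s. 0 < Re s} - {1}"
      "\<And>s. Re s > 1 \<Longrightarrow> f s = (\<Sum>n. 1 / of_nat (Suc n) powr s)"
    by (rule zeta_continuation_exists) blast
  have "zeta z = f z"
    by (rule zeta_eqI[OF _ _ f]) (use assms in auto)
  thus ?thesis
    using assms f(2) by simp
qed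

lemma inverse_powr_of_real:
  "1 / complex_of_nat (Suc n) powr complex_of_real t = of_real (real (Suc n) powr - t)"
  using powr_of_real[of "real (Suc n)" t] by (simp add: powr_minus divide_inverse del: of_nat_Suc)

lemma summable_Suc_powr: "t > 1 \<Longrightarrow> summable (\<lambda>n. real (Suc n) powr - t)"
  by (subst summable_Suc_iff) (simp add: summable_real_powr_iff)

text \<open>Nonnegative terms turn ordered convergence of a series indexed from 0 into unordered
  convergence over the positive integers.\<close>

lemma has_dseries_Suc:
  assumes "(\<lambda>n. c (Suc n) * real (Suc n) powr - t) sums S" "\<And>n. n > 0 \<Longrightarrow> c n \<ge> 0"
  shows "has_dseries c t S"
proof -
  have "((\<lambda>n. c (Suc n) * real (Suc n) powr - t) has_sum S) UNIV"
    using assms by (intro sums_nonneg_imp_has_sum) (auto simp del: of_nat_Suc)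
  also have "?this \<longleftrightarrow> has_dseries c t S"
    unfolding has_dseries_def
    by (rule has_sum_reindex_bij_witness[where i = "\<lambda>n. n - 1" and j = Suc]) auto
  finally show ?thesis .
qed

lemma has_dseries_zeta:
  assumes "t > 1"
  shows "has_dseries (\<lambda>_. 1) t (zeta_real t)"
proof (rule has_dseries_Suc)
  have sm: "summable (\<lambda>n. real (Suc n) powr - t)"
    using assms by (rule summable_Suc_powr)
  have "zeta (of_real t) = (\<Sum>n. of_real (real (Suc n) powr - t))"
    using assms by (subst zeta_eq_suminf) (simp_all only: inverse_powr_of_real Re_complex_of_real)
  also have "\<dots> = of_real (\<Sum>n. real (Suc n) powr - t)"
    by (rule suminf_of_real[OF sm, symmetric])
  finally show "(\<lambda>n. 1 * real (Suc n) powr - t) sums zeta_real t"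
    using sm by (simp add: summable_sums)
qed simp

text \<open>Termwise differentiation of the zeta series, justified by local uniform convergence on
  the half-plane \<open>Re z > 1\<close>.\<close>

lemma has_dseries_ln:
  assumes "t > 1"
  shows "has_dseries (\<lambda>n. ln (real n)) t (- zeta_real' t)"
proof (rule has_dseries_Suc)
  define S where "S = {z. Re z > 1}"
  have S: "open S"
    unfolding S_def by (rule open_halfspace_Re_gt)
  define f where "f = (\<lambda>n z. 1 / complex_of_nat (Suc n) powr z)"
  define f' where "f' = (\<lambda>n z. - complex_of_real (ln (real (Suc n))) / complex_of_nat (Suc n) powr z)"
  have "\<exists>g g'. \<forall>z\<in>S. ((\<lambda>n. f n z) sums g z) \<and> ((\<lambda>n. f' n z) sums g' z) \<and>
      (g has_field_derivative g' z) (at z)"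
  proof (rule series_and_derivative_comparison_local[OF S])
    fix n z
    have "((\<lambda>z. complex_of_nat (Suc n) powr - z) has_field_derivative
        - Ln (of_nat (Suc n)) * of_nat (Suc n) powr - z) (at z)"
      using DERIV_chain2[OF has_field_derivative_powr_right[of "complex_of_nat (Suc n)" "- z"]
          DERIV_minus[OF DERIV_ident]]
      by (simp del: of_nat_Suc)
    thus "(f n has_field_derivative f' n z) (at z)"
      by (simp add: f_def f'_def powr_minus divide_inverse Ln_of_nat del: of_nat_Suc)
  next
    fix z assume "z \<in> S"
    \<comment> \<open>Half the distance to the line \<open>Re = 1\<close>: the ball of radius
      \<open>d\<close> lies in \<open>Re y > 1 + d\<close>, where the terms have a common summable
      majorant.\<close>
    define d where "d = (Re z - 1) / 2"
    have d: "d > 0" using \<open>z \<in> S\<close> by (simp add: d_def S_def)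
    have "cmod (f n y) \<le> real (Suc n) powr - (1 + d)" if "y \<in> ball z d" for n y
    proof -
      have "\<bar>Re (z - y)\<bar> < d"
        using that abs_Re_le_cmod[of "z - y"] by (simp add: dist_norm)
      hence "Re y > 1 + d" by (simp add: d_def abs_if field_simps split: if_splits)
      hence "real (Suc n) powr - Re y \<le> real (Suc n) powr - (1 + d)"
        by (intro powr_mono) auto
      moreover have "cmod (f n y) = real (Suc n) powr - Re y"
        unfolding f_def norm_divide
        by (subst norm_powr_real_powr) (auto simp: powr_minus divide_inverse)
      ultimately show ?thesis by simp
    qed
    thus "\<exists>d h. 0 < d \<and> summable h \<and>
        (\<forall>\<^sub>F n in sequentially. \<forall>y\<in>ball z d \<inter> S. cmod (f n y) \<le> h n)"
      using d by (intro exI[of _ d] exI[of _ "\<lambda>n. real (Suc n) powr - (1 + d)"])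
        (use summable_Suc_powr[of "1 + d"] in \<open>auto intro!: always_eventually simp del: of_nat_Suc\<close>)
  qed
  then obtain g g' where g: "\<And>z. z \<in> S \<Longrightarrow> (\<lambda>n. f n z) sums g z"
      "\<And>z. z \<in> S \<Longrightarrow> (\<lambda>n. f' n z) sums g' z"
      "\<And>z. z \<in> S \<Longrightarrow> (g has_field_derivative g' z) (at z)"
    by blast
  have t: "complex_of_real t \<in> S"
    using assms by (simp add: S_def)
  have "zeta z = g z" if "z \<in> S" for z
    using g(1)[OF that] that by (simp add: S_def zeta_eq_suminf f_def sums_iff del: of_nat_Suc)
  hence "(zeta has_field_derivative g' (of_real t)) (at (of_real t))"
    by (intro has_field_derivative_transform_within_open[OF g(3)[OF t] S t]) simp
  hence "deriv zeta (of_real t) = g' (of_real t)"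
    by (rule DERIV_imp_deriv)
  hence "(\<lambda>n. - f' n (of_real t)) sums - deriv zeta (of_real t)"
    using sums_minus[OF g(2)[OF t]] by simp
  moreover have "- f' n (of_real t) = of_real (ln (real (Suc n)) * real (Suc n) powr - t)" for n
    using inverse_powr_of_real[of n t] by (simp add: f'_def divide_inverse del: of_nat_Suc)
  ultimately have "(\<lambda>n. complex_of_real (ln (real (Suc n)) * real (Suc n) powr - t)) sums
      - deriv zeta (of_real t)"
    by (simp only:)
  from sums_Re[OF this] show "(\<lambda>n. ln (real (Suc n)) * real (Suc n) powr - t) sums - zeta_real' t"
    by (simp del: of_nat_Suc)
qed simp

section \<open>Dirichlet series of the coefficient functions\<close>

lemma has_dseries_unit: "has_dseries dirichlet_unit t 1"
  unfolding has_dseries_def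
  by (rule has_sum_finite_neutralI[where B = "{1}"]) (auto simp: dirichlet_unit_def)

lemma abs_moebius_mu_le: "\<bar>moebius_mu n\<bar> \<le> 1"
  by (simp add: moebius_mu_def power_abs)

text \<open>Comparison with zeta gives some sum \<open>M\<close>; the identity
  \<open>moebius_mu_conv_one\<close> forces \<open>M * zeta_real t = 1\<close>, which yields the
  value and the nonvanishing together.\<close>

lemma
  assumes "t > 1"
  shows has_dseries_moebius_mu: "has_dseries moebius_mu t (1 / zeta_real t)"
    and zeta_real_neq_0: "zeta_real t \<noteq> 0"
proof -
  obtain M where M: "has_dseries moebius_mu t M"
    by (rule has_dseries_comparison'[OF has_dseries_zeta[OF assms], of moebius_mu])
       (use abs_moebius_mu_le in blast)+
  have "has_dseries dirichlet_unit t (M * zeta_real t)"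
    using has_dseries_dirichlet_conv[OF M has_dseries_zeta[OF assms]]
    by (simp add: moebius_mu_conv_one)
  hence "M * zeta_real t = 1"
    using has_dseries_unit has_dseries_unique by blast
  moreover from this show "zeta_real t \<noteq> 0"
    by auto
  ultimately have "M = 1 / zeta_real t"
    by (simp add: field_simps)
  thus "has_dseries moebius_mu t (1 / zeta_real t)"
    using M by simp
qed

text \<open>From \<open>mangoldt_conv_one\<close>, the series of \<open>mangoldt\<close> times zeta
  is minus the derivative of zeta; a second division by zeta accounts for
  \<open>moebius_mu\<close>.\<close>

lemma has_dseries_moebius_mu_mangoldt:
  assumes "t > 1"
  shows "has_dseries (moebius_mu \<star> mangoldt) t (- zeta_real' t / zeta_real t ^ 2)"
proof -
  have "\<bar>mangoldt n\<bar> \<le> ln (real n)" if "n > 0" for n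
    using mangoldt_le[OF that] by simp
  then obtain M where M: "has_dseries mangoldt t M"
    using has_dseries_comparison'[OF has_dseries_ln[OF assms]] by blast
  have "has_dseries (\<lambda>n. ln (real n)) t (M * zeta_real t)"
    using has_dseries_dirichlet_conv[OF M has_dseries_zeta[OF assms]]
    by (simp add: mangoldt_conv_one)
  hence "M * zeta_real t = - zeta_real' t"
    using has_dseries_ln[OF assms] has_dseries_unique by blast
  hence "1 / zeta_real t * M = - zeta_real' t / zeta_real t ^ 2"
    using zeta_real_neq_0[OF assms] by (simp add: field_simps power2_eq_square)
  thus ?thesis
    using has_dseries_dirichlet_conv[OF has_dseries_moebius_mu[OF assms] M] by simp
qed

lemma has_dseries_moebius_mu_moebius_mu:
  assumes "t > 1"
  shows "has_dseries (moebius_mu \<star> moebius_mu) t (1 / zeta_real t ^ 2)"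
  using has_dseries_dirichlet_conv[OF has_dseries_moebius_mu[OF assms] has_dseries_moebius_mu[OF assms]]
  by (simp add: power2_eq_square)

text \<open>
  No termwise differentiation is needed: multiplication by \<open>ln\<close> is a derivation of the
  convolution algebra, and applied to \<open>\<mu> * 1\<close> it determines the series of \<open>\<mu> ln\<close>.
\<close>

lemma has_dseries_moebius_mu_moebius_mu_ln:
  assumes "t > 1"
  shows "has_dseries (\<lambda>n. (moebius_mu \<star> moebius_mu) n * ln (real n)) t
           (2 * zeta_real' t / zeta_real t ^ 3)"
proof -
  define m where "m = (\<lambda>n. moebius_mu n * ln (real n))"
  note mu = has_dseries_moebius_mu[OF assms]
  have "\<bar>m n\<bar> \<le> ln (real n)" if "n > 0" for n
    using that abs_moebius_mu_le[of n] mult_right_mono[of "\<bar>moebius_mu n\<bar>" 1 "ln (real n)"]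
    by (simp add: m_def abs_mult)
  then obtain M where M: "has_dseries m t M"
    using has_dseries_comparison'[OF has_dseries_ln[OF assms]] by blast
  have "has_dseries (\<lambda>n. (m \<star> (\<lambda>_. 1)) n + (moebius_mu \<star> (\<lambda>n. ln (real n))) n) t
          (M * zeta_real t + 1 / zeta_real t * - zeta_real' t)"
    by (rule has_dseries_add[OF has_dseries_dirichlet_conv[OF M has_dseries_zeta[OF assms]]
          has_dseries_dirichlet_conv[OF mu has_dseries_ln[OF assms]]])
  also have "(\<lambda>n. (m \<star> (\<lambda>_. 1)) n + (moebius_mu \<star> (\<lambda>n. ln (real n))) n) = (\<lambda>_. 0)"
  proof
    fix n show "(m \<star> (\<lambda>_. 1)) n + (moebius_mu \<star> (\<lambda>n. ln (real n))) n = 0"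
      using dirichlet_conv_ln[of moebius_mu "\<lambda>_. 1" n]
      by (cases "n = 1") (auto simp: moebius_mu_conv_one dirichlet_unit_def m_def)
  qed
  finally have "M * zeta_real t + 1 / zeta_real t * - zeta_real' t = 0"
    by (rule has_dseries_unique) (simp add: has_dseries_def)
  hence "M = zeta_real' t / zeta_real t ^ 2"
    using zeta_real_neq_0[OF assms] by (simp add: field_simps power2_eq_square)
  moreover have "has_dseries (\<lambda>n. (m \<star> moebius_mu) n + (moebius_mu \<star> m) n) t
      (M * (1 / zeta_real t) + 1 / zeta_real t * M)"
    by (rule has_dseries_add[OF has_dseries_dirichlet_conv[OF M mu] has_dseries_dirichlet_conv[OF mu M]])
  moreover have "(\<lambda>n. (moebius_mu \<star> moebius_mu) n * ln (real n)) =
      (\<lambda>n. (m \<star> moebius_mu) n + (moebius_mu \<star> m) n)"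
    by (simp add: dirichlet_conv_ln m_def)
  ultimately show ?thesis
    by (simp add: power2_eq_square power3_eq_cube field_simps)
qed

text \<open>Integral comparison: for \<open>n \<ge> 2\<close> each term is at most the integral of
  \<open>u powr - (1 + e)\<close> over \<open>[n - 1, n]\<close>. These telescope to
  \<open>1 / e\<close>, and the first term of the series contributes 1.\<close>

lemma zeta_real_le:
  assumes "0 < e"
  shows "zeta_real (1 + e) \<le> 1 + 1 / e"
proof -
  have "(\<lambda>n. real (Suc n) powr - e) \<longlonglongrightarrow> 0"
    using assms by real_asymp
  from telescope_sums'[OF this]
  have tel: "(\<lambda>n. (real (Suc n) powr - e - real (Suc (Suc n)) powr - e) / e) sums (1 / e)"
    using sums_divide[where c = e] by fastforce
  have step: "real (Suc (Suc n)) powr - (1 + e) \<le> (real (Suc n) powr - e - real (Suc (Suc n)) powr - e) / e" for n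
  proof -
    have "\<exists>z::real. z > real (Suc n) \<and> z < real (Suc (Suc n)) \<and>
        real (Suc (Suc n)) powr - e - real (Suc n) powr - e =
        (real (Suc (Suc n)) - real (Suc n)) * (- e * z powr (- e - 1))"
      by (rule MVT2) (auto intro!: derivative_eq_intros)
    then obtain z where z: "z > real (Suc n)" "z < real (Suc (Suc n))"
        "real (Suc n) powr - e - real (Suc (Suc n)) powr - e = e * z powr (- e - 1)"
      by (auto simp: algebra_simps)
    have exp: "- (1 + e) = - e - 1"
      by simp
    have "real (Suc (Suc n)) powr (- e - 1) \<le> z powr (- e - 1)"
      using z assms by (intro powr_mono2') auto
    also have "\<dots> = (real (Suc n) powr - e - real (Suc (Suc n)) powr - e) / e"
      using z(3) assms by (simp add: field_simps)
    finally show ?thesis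
      unfolding exp .
  qed
  have "(\<lambda>n. real (Suc n) powr - (1 + e)) sums zeta_real (1 + e)"
  proof -
    have "((\<lambda>n. real (Suc n) powr - (1 + e)) has_sum zeta_real (1 + e)) UNIV \<longleftrightarrow>
        has_dseries (\<lambda>_. 1) (1 + e) (zeta_real (1 + e))"
      unfolding has_dseries_def
      by (rule has_sum_reindex_bij_witness[where i = "\<lambda>n. n - 1" and j = Suc]) auto
    thus ?thesis
      using has_dseries_zeta[of "1 + e"] assms by (auto intro: has_sum_imp_sums)
  qed
  hence "(\<lambda>n. real (Suc (Suc n)) powr - (1 + e)) sums (zeta_real (1 + e) - 1)"
    using sums_Suc_iff[of "\<lambda>n. real (Suc n) powr - (1 + e)" "zeta_real (1 + e) - 1"] by simp
  from sums_le[OF step this tel] show ?thesis by simp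
qed

section \<open>Zeta on the half-plane \<open>Re z > 0\<close> and sums of powers\<close>

lemma zeta_sums:
  assumes "Re z > 0" "z \<noteq> 1"
  shows "(\<lambda>n. 1 / of_nat (Suc n) powr z
            - (of_nat (n + 2) powr (1 - z) - of_nat (Suc n) powr (1 - z)) / (1 - z))
         sums (zeta z - 1 / (z - 1))"
proof -
  define S where "S = {z. 0 < Re z} - {1::complex}"
  \<comment> \<open>Each term is reduced by the integral of \<open>u powr - z\<close> over
    \<open>[n + 1, n + 2]\<close>. The difference is of order \<open>n powr (- Re z - 1)\<close>, so
    the series converges for \<open>Re z > 0\<close>; the pole term restores what was
    subtracted.\<close>
  define G where "G = (\<lambda>n z. 1 / of_nat (Suc n) powr z
      - (of_nat (n + 2) powr (1 - z) - of_nat (Suc n) powr (1 - z)) / (1 - z) :: complex)"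
  have S: "open S"
    unfolding S_def by (intro open_Diff open_halfspace_Re_gt) auto
  have "\<exists>g g'. \<forall>z\<in>S. (\<lambda>n. G n z) sums g z \<and> (\<lambda>n. deriv (G n) z) sums g' z \<and>
      (g has_field_derivative g' z) (at z)"
  proof (rule series_and_derivative_comparison_local[OF S])
    fix n z assume "z \<in> S"
    moreover have "of_nat (Suc k) \<noteq> (0 :: complex)" for k
      by (rule of_nat_neq_0)
    hence "G n holomorphic_on S"
      unfolding G_def S_def by (intro holomorphic_intros) (auto simp del: of_nat_Suc)
    ultimately show "(G n has_field_derivative deriv (G n) z) (at z)"
      using S by (intro holomorphic_derivI)
  next
    fix z assume z: "z \<in> S"
    define d where "d = Re z / 2"
    have d: "d > 0" using z by (simp add: d_def S_def)
    have "summable (\<lambda>n. real (Suc n) powr - (d + 1))"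
      using d by (subst summable_Suc_iff) (simp add: summable_real_powr_iff)
    hence "summable (\<lambda>n. (norm z + d) * real (Suc n) powr - (d + 1))"
      by (rule summable_mult)
    moreover have "norm (G n y) \<le> (norm z + d) * real (Suc n) powr - (d + 1)"
      if y: "y \<in> ball z d \<inter> S" for n y
    proof -
      have dist: "norm (z - y) < d" using y by (simp add: dist_norm)
      hence "\<bar>Re (z - y)\<bar> < d" using abs_Re_le_cmod[of "z - y"] by linarith
      hence Re: "Re y > d" by (simp add: d_def abs_if split: if_splits)
      have ny: "norm y \<le> norm z + d"
        using dist norm_triangle_ineq2[of y z] by (simp add: norm_minus_commute)
      have "norm (G n y) \<le> norm y * real (Suc n) powr (- Re y - 1)"
        using zeta_term_bound[of y n] y unfolding G_def S_def by simp
      also have "\<dots> \<le> (norm z + d) * real (Suc n) powr - (d + 1)"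
        using Re ny d by (intro mult_mono powr_mono) auto
      finally show ?thesis .
    qed
    ultimately show "\<exists>d h. 0 < d \<and> summable h \<and>
        (\<forall>\<^sub>F n in sequentially. \<forall>y\<in>ball z d \<inter> S. norm (G n y) \<le> h n)"
      using d by (intro exI[of _ d] exI[of _ "\<lambda>n. (norm z + d) * real (Suc n) powr - (d + 1)"]
          conjI always_eventually allI ballI)
  qed
  then obtain g g' where g: "\<And>z. z \<in> S \<Longrightarrow> (\<lambda>n. G n z) sums g z"
      "\<And>z. z \<in> S \<Longrightarrow> (g has_field_derivative g' z) (at z)"
    by blast
  have "zeta z = 1 / (z - 1) + g z"
  proof (rule zeta_eqI[of 0])
    have "g holomorphic_on S"
      using S g(2) by (auto simp: holomorphic_on_open)
    thus "(\<lambda>z. 1 / (z - 1) + g z) holomorphic_on {s. 0 < Re s} - {1}"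
      unfolding S_def by (auto intro!: holomorphic_intros)
  next
    fix z :: complex assume z: "Re z > 1"
    hence z': "z \<in> S" "z \<noteq> 1" by (auto simp: S_def)
    have "(\<lambda>n. real (Suc n) powr (1 - Re z)) \<longlonglongrightarrow> 0"
      using z by real_asymp
    moreover have "norm (of_nat (Suc n) powr (1 - z) :: complex) = real (Suc n) powr (1 - Re z)" for n
      by (subst norm_powr_real_powr) auto
    ultimately have "(\<lambda>n. norm (of_nat (Suc n) powr (1 - z) :: complex)) \<longlonglongrightarrow> 0"
      by simp
    hence "(\<lambda>n. of_nat (Suc n) powr (1 - z) :: complex) \<longlonglongrightarrow> 0"
      using tendsto_norm_zero_iff by blast
    \<comment> \<open>For \<open>Re z > 1\<close> the subtracted integrals telescope to
      \<open>1 / (z - 1)\<close>, which is the term added to \<open>g\<close>.\<close>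
    from telescope_sums[OF this]
    have "(\<lambda>n. of_nat (n + 2) powr (1 - z) - of_nat (Suc n) powr (1 - z)) sums (- 1 :: complex)"
      by simp
    from sums_add[OF g(1)[OF z'(1)] sums_divide[OF this, of "1 - z"]]
    have "(\<lambda>n. 1 / of_nat (Suc n) powr z) sums (g z + (- 1) / (1 - z))"
      by (simp add: G_def)
    moreover have "(- 1) / (1 - z) = 1 / (z - 1)"
      using z'(2) by (simp add: field_simps)
    ultimately show "1 / (z - 1) + g z = (\<Sum>n. 1 / of_nat (Suc n) powr z)"
      by (simp add: sums_iff add.commute)
  qed (use assms in auto)
  thus ?thesis
    using g(1)[of z] assms by (simp add: S_def G_def)
qed

text \<open>The series of \<open>zeta_sums\<close> at \<open>z = - a\<close>: its partial sums
  telescope in the integral part, and the constants \<open>1 / (1 + a)\<close> cancel.\<close>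

lemma powr_sum_tendsto_zeta:
  assumes "-1 < a" "a < 0"
  shows "(\<lambda>N. (\<Sum>n = 1..N. real n powr a) - real (Suc N) powr (1 + a) / (1 + a))
           \<longlonglongrightarrow> zeta_real (- a)"
proof -
  define P where "P n = real (Suc n) powr a
      - (real (Suc (Suc n)) powr (1 + a) - real (Suc n) powr (1 + a)) / (1 + a)" for n
  have P: "1 / of_nat (Suc n) powr complex_of_real (- a)
            - (of_nat (n + 2) powr (1 - complex_of_real (- a)) - of_nat (Suc n) powr (1 - complex_of_real (- a)))
              / (1 - complex_of_real (- a)) = of_real (P n)" for n
    using powr_of_real[of "real (Suc n)" a] powr_of_real[of "real (Suc n)" "1 + a"]
      powr_of_real[of "real (Suc (Suc n))" "1 + a"]
    by (simp add: P_def powr_minus divide_inverse del: of_nat_Suc)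
  have "complex_of_real (- a) \<noteq> 1"
    using assms unfolding of_real_eq_1_iff by simp
  hence "(\<lambda>n. complex_of_real (P n)) sums (zeta (of_real (- a)) - 1 / (of_real (- a) - 1))"
    using zeta_sums[of "of_real (- a)"] assms unfolding P by simp
  moreover have "1 / (complex_of_real (- a) - 1) = of_real (1 / (- a - 1))"
    by (simp only: of_real_divide of_real_diff of_real_1)
  ultimately have "P sums (zeta_real (- a) - 1 / (- a - 1))"
    by (metis sums_Re Re_complex_of_real minus_complex.simps(1) sums_cong)
  also have "zeta_real (- a) - 1 / (- a - 1) = zeta_real (- a) + 1 / (1 + a)"
    using assms by (simp add: field_simps)
  finally have "P sums (zeta_real (- a) + 1 / (1 + a))" .
  moreover have "(\<Sum>n<N. P n) = (\<Sum>n = 1..N. real n powr a) - (real (Suc N) powr (1 + a) - 1) / (1 + a)" for N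
    by (induction N) (simp_all add: P_def diff_divide_distrib)
  ultimately have "(\<lambda>N. (\<Sum>n = 1..N. real n powr a) - (real (Suc N) powr (1 + a) - 1) / (1 + a))
      \<longlonglongrightarrow> zeta_real (- a) + 1 / (1 + a)"
    by (simp add: sums_def)
  from tendsto_diff[OF this tendsto_const[of "1 / (1 + a)"]] show ?thesis
    by (simp add: diff_divide_distrib)
qed

text \<open>The middle quantity is the integral of the decreasing function \<open>t powr a\<close>
  over \<open>[u, v]\<close>, compared with its endpoint values.\<close>

lemma powr_diff_bounds:
  fixes a u v :: real
  assumes "-1 < a" "a < 0" "0 < u" "u \<le> v"
  shows "(v powr (1 + a) - u powr (1 + a)) / (1 + a) \<le> (v - u) * u powr a"
    and "(v - u) * v powr a \<le> (v powr (1 + a) - u powr (1 + a)) / (1 + a)"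
proof -
  consider "u = v" | "u < v" using assms by linarith
  hence "(v powr (1 + a) - u powr (1 + a)) / (1 + a) \<le> (v - u) * u powr a \<and>
      (v - u) * v powr a \<le> (v powr (1 + a) - u powr (1 + a)) / (1 + a)"
  proof cases
    case 2
    have "\<exists>z. z > u \<and> z < v \<and> v powr (1 + a) - u powr (1 + a) = (v - u) * ((1 + a) * z powr a)"
      using 2 assms by (intro MVT2) (auto intro!: derivative_eq_intros)
    then obtain z where z: "u < z" "z < v"
        "v powr (1 + a) - u powr (1 + a) = (v - u) * ((1 + a) * z powr a)"
      by blast
    have "(v powr (1 + a) - u powr (1 + a)) / (1 + a) = (v - u) * z powr a"
      using z(3) assms by simp
    moreover have "v powr a \<le> z powr a" "z powr a \<le> u powr a"
      using z assms by (auto intro!: powr_mono2')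
    ultimately show ?thesis
      using 2 by simp
  qed simp
  thus "(v powr (1 + a) - u powr (1 + a)) / (1 + a) \<le> (v - u) * u powr a"
    "(v - u) * v powr a \<le> (v powr (1 + a) - u powr (1 + a)) / (1 + a)"
    by auto
qed

text \<open>
  \<open>\<zeta>(-a)\<close> is the common limit of an increasing and a decreasing sequence whose difference is
  \<open>(N + 1)\<^sup>a\<close>.
\<close>

lemma powr_sum_asymp:
  assumes a: "-1 < a" "a < 0" and y: "y \<ge> 1"
  shows "\<bar>(\<Sum>n = 1..nat \<lfloor>y\<rfloor>. real n powr a) - (y powr (1 + a) / (1 + a) + zeta_real (- a))\<bar>
           \<le> y powr a"
proof -
  define S where "S N = (\<Sum>n = 1..N. real n powr a)" for N
  define U where "U N = S N - real (Suc N) powr (1 + a) / (1 + a)" for N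
  define V where "V N = S N - real (Suc N) powr (1 + a) / (1 + a) + real (Suc N) powr a" for N
  note diff = powr_diff_bounds[OF a]
  have lim: "U \<longlonglongrightarrow> zeta_real (- a)"
    unfolding U_def S_def using powr_sum_tendsto_zeta[OF a] .
  have "(\<lambda>N. real (Suc N) powr a) \<longlonglongrightarrow> 0"
    using a by real_asymp
  from tendsto_add[OF lim this] have limV: "V \<longlonglongrightarrow> zeta_real (- a)"
    by (simp add: U_def V_def[abs_def])
  have "incseq U"
  proof (rule incseq_SucI)
    fix N
    show "U N \<le> U (Suc N)"
      using diff(1)[of "real (Suc N)" "real (Suc (Suc N))"]
      by (simp add: U_def S_def diff_divide_distrib)
  qed
  hence U: "U N \<le> zeta_real (- a)" for N
    using lim by (rule incseq_le)
  have "decseq V"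
  proof (rule decseq_SucI)
    fix N
    show "V (Suc N) \<le> V N"
      using diff(2)[of "real (Suc N)" "real (Suc (Suc N))"]
      by (simp add: V_def S_def diff_divide_distrib)
  qed
  hence V: "zeta_real (- a) \<le> V N" for N
    using limV by (rule decseq_ge)
  define N where "N = nat \<lfloor>y\<rfloor>"
  have N: "real N \<le> y" "y \<le> real (Suc N)"
    using y unfolding N_def by linarith+
  \<comment> \<open>The gap to the limit and the cost of replacing \<open>N + 1\<close> by
    \<open>y\<close> have opposite signs and are each at most \<open>y powr a\<close>; hence the
    constant 1.\<close>
  have "real (Suc N) powr a \<le> y powr a"
    using N y a by (intro powr_mono2') auto
  moreover have "(real (Suc N) - y) * y powr a \<le> 1 * y powr a"
    using N by (intro mult_right_mono) auto
  moreover have "0 \<le> (real (Suc N) - y) * real (Suc N) powr a"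
    using N by simp
  ultimately show ?thesis
    using U[of N] V[of N] diff[of y "real (Suc N)"] N y
    unfolding U_def V_def S_def abs_le_iff diff_divide_distrib N_def[symmetric] by linarith
qed

subsection \<open>Reduction to sums of Dirichlet convolutions\<close>

lemma dirichlet_conv_unit_right': "f \<star> g \<star> dirichlet_unit = f \<star> g"
proof
  fix n show "(f \<star> g \<star> dirichlet_unit) n = (f \<star> g) n"
    by (cases "n = 0") (simp_all add: dirichlet_conv_unit_right)
qed

lemma powr_neg_of_nat: "n > 0 \<Longrightarrow> real n powr - real s = 1 / real n ^ s"
  by (simp add: powr_minus powr_realpow divide_inverse)

text \<open>With \<open>k = d * e\<close>, the multiples of \<open>d ^ s\<close> up to
  \<open>k ^ s\<close> are \<open>d ^ s * m\<close> with \<open>m \<le> e ^ s\<close>, and the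
  argument of Gamma becomes \<open>m / e ^ s\<close>. The multiplication formula with
  \<open>N = e ^ s\<close> evaluates each inner sum.\<close>

lemma sum_ln_Gamma_dirichlet_conv:
  assumes k: "k > 0"
  shows "(\<Sum>j = 1..k ^ s. ln (Gamma (real j / real (k ^ s))) * (\<Sum>d | d dvd k \<and> d ^ s dvd j. g d)) =
           ln (sqrt (2 * pi)) * ((g \<star> id_pow (real s)) k - (g \<star> (\<lambda>_. 1)) k)
           - real s / 2 * (g \<star> (\<lambda>n. ln (real n))) k"
proof -
  define G where "G j = ln (Gamma (real j / real (k ^ s)))" for j
  have "(\<Sum>j = 1..k ^ s. G j * (\<Sum>d | d dvd k \<and> d ^ s dvd j. g d)) =
        (\<Sum>j = 1..k ^ s. \<Sum>d | d \<in> {d. d dvd k} \<and> d ^ s dvd j. G j * g d)"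
    by (simp add: sum_distrib_left)
  also have "\<dots> = (\<Sum>d | d dvd k. \<Sum>j | j \<in> {1..k ^ s} \<and> d ^ s dvd j. G j * g d)"
    using k by (intro sum.swap_restrict) auto
  also have "\<dots> = (\<Sum>d | d dvd k. g d * (ln (sqrt (2 * pi)) * (id_pow (real s) (k div d) - 1)
                     - real s / 2 * ln (real (k div d))))"
  proof (rule sum.cong)
    fix d assume "d \<in> {d. d dvd k}"
    then obtain e where e: "k = d * e" by auto
    have pos: "d > 0" "e > 0" using e k by auto
    have "(\<Sum>j | j \<in> {1..k ^ s} \<and> d ^ s dvd j. G j * g d) =
          (\<Sum>m = 1..e ^ s. ln (Gamma (real m / real (e ^ s))) * g d)"
    proof (rule sum.reindex_bij_witness[where i = "\<lambda>m. d ^ s * m" and j = "\<lambda>j. j div d ^ s"])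
      fix j assume j: "j \<in> {j. j \<in> {1..k ^ s} \<and> d ^ s dvd j}"
      then obtain m where m: "j = d ^ s * m" by auto
      show "d ^ s * (j div d ^ s) = j" "j div d ^ s \<in> {1..e ^ s}"
          "ln (Gamma (real (j div d ^ s) / real (e ^ s))) * g d = G j * g d"
        using j pos by (auto simp: m e G_def power_mult_distrib Suc_le_eq)
    next
      fix m assume "m \<in> {1..e ^ s}"
      thus "d ^ s * m div d ^ s = m" "d ^ s * m \<in> {j. j \<in> {1..k ^ s} \<and> d ^ s dvd j}"
        using pos by (auto simp: e power_mult_distrib Suc_le_eq)
    qed
    also have "\<dots> = g d * (\<Sum>m = 1..e ^ s. ln (Gamma (real m / real (e ^ s))))"
      by (simp add: sum_distrib_left mult.commute)
    also have "(\<Sum>m = 1..e ^ s. ln (Gamma (real m / real (e ^ s)))) =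
        (real (e ^ s) - 1) * ln (sqrt (2 * pi)) - ln (real (e ^ s)) / 2"
      using pos by (intro sum_ln_Gamma_fractions) auto
    finally show "(\<Sum>j | j \<in> {1..k ^ s} \<and> d ^ s dvd j. G j * g d) =
        g d * (ln (sqrt (2 * pi)) * (id_pow (real s) (k div d) - 1) - real s / 2 * ln (real (k div d)))"
      using pos by (simp add: e id_pow_def powr_realpow ln_realpow mult.commute)
  qed simp
  also have "\<dots> = ln (sqrt (2 * pi)) * ((g \<star> id_pow (real s)) k - (g \<star> (\<lambda>_. 1)) k)
                   - real s / 2 * (g \<star> (\<lambda>n. ln (real n))) k"
    unfolding dirichlet_conv_def sum_distrib_left sum_subtractf[symmetric]
    by (intro sum.cong) (simp_all add: algebra_simps)
  finally show ?thesis
    unfolding G_def .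
qed

text \<open>Division by \<open>k ^ s\<close> is the twist \<open>tw\<close>, a homomorphism for
  convolution, so the simplification takes place in the convolution algebra before summing over
  \<open>k\<close>. The value \<open>a = 0\<close> is included and serves the first formula.\<close>

lemma A_phi_eq:
  fixes s :: nat and a x :: real
  defines "b \<equiv> real s + a"
  shows "A s x (phi b) =
     ln (sqrt (2 * pi)) * (\<Sum>d = 1..nat \<lfloor>x\<rfloor>. (moebius_mu \<star> moebius_mu) d / real d ^ s *
                             (\<Sum>n = 1..nat \<lfloor>x / real d\<rfloor>. sigma a n))
     - ln (sqrt (2 * pi)) * (\<Sum>d = 1..nat \<lfloor>x\<rfloor>. moebius_mu d / real d ^ s *
                             (\<Sum>n = 1..nat \<lfloor>x / real d\<rfloor>. real n powr a))
     - real s / 2 * (\<Sum>d = 1..nat \<lfloor>x\<rfloor>. (moebius_mu \<star> mangoldt) d / real d ^ s *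
                             (\<Sum>n = 1..nat \<lfloor>x / real d\<rfloor>. real n powr a))"
proof -
  define L where "L = ln (sqrt (2 * pi))"
  define g where "g = phi b \<star> moebius_mu"
  define tw where "tw f = (\<lambda>n. f n * real n powr - real s)" for f :: "nat \<Rightarrow> real"
  define one where "one = (\<lambda>_ :: nat. 1 :: real)"
  have tw_conv: "tw (f \<star> h) = tw f \<star> tw h" for f h
    by (simp add: tw_def dirichlet_conv_powr)
  have tw_id: "tw (id_pow c) = (\<lambda>n. real n powr (c - real s))" for c
    by (simp add: tw_def id_pow_def powr_diff powr_minus divide_inverse)
  have "g \<star> id_pow (real s) = (moebius_mu \<star> moebius_mu) \<star> (id_pow b \<star> id_pow (real s))"
    by (simp add: g_def phi_def dirichlet_conv_ac)
  \<comment> \<open>The twist lowers exponents by \<open>s\<close>: the factors become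
    \<open>n powr a\<close> and the constant 1, whose convolution is \<open>sigma a\<close>.\<close>
  moreover have "tw (id_pow b) \<star> tw (id_pow (real s)) = sigma a"
  proof
    fix n show "(tw (id_pow b) \<star> tw (id_pow (real s))) n = sigma a n"
    proof (cases "n = 0")
      case False
      thus ?thesis
        by (auto simp: tw_id dirichlet_conv_def sigma_def b_def dvd_div_eq_0_iff intro!: sum.cong)
    qed (simp add: sigma_def)
  qed
  ultimately have 1: "tw (g \<star> id_pow (real s)) = tw (moebius_mu \<star> moebius_mu) \<star> sigma a"
    by (simp add: tw_conv)
  have "g \<star> one = phi b \<star> dirichlet_unit"
    by (simp add: g_def one_def dirichlet_conv_assoc moebius_mu_conv_one)
  also have "\<dots> = moebius_mu \<star> id_pow b"
    by (simp only: phi_def dirichlet_conv_unit_right' dirichlet_conv_commute[of "id_pow b"])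
  finally have 2: "tw (g \<star> one) = tw moebius_mu \<star> (\<lambda>n. real n powr a)"
    by (simp add: tw_conv tw_id b_def)
  \<comment> \<open>Writing the logarithm as \<open>mangoldt \<star> one\<close> frees a factor
    \<open>one\<close> that cancels one \<open>moebius_mu\<close> of \<open>g\<close>.\<close>
  have "g \<star> (\<lambda>n. ln (real n)) = phi b \<star> moebius_mu \<star> (mangoldt \<star> one)"
    by (simp add: g_def one_def mangoldt_conv_one)
  also have "\<dots> = phi b \<star> mangoldt \<star> (moebius_mu \<star> one)"
    by (simp only: dirichlet_conv_ac)
  also have "\<dots> = phi b \<star> mangoldt"
    by (simp add: one_def moebius_mu_conv_one dirichlet_conv_unit_right')
  also have "\<dots> = moebius_mu \<star> mangoldt \<star> id_pow b"
    by (simp only: phi_def dirichlet_conv_ac)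
  finally have 3: "tw (g \<star> (\<lambda>n. ln (real n))) = tw (moebius_mu \<star> mangoldt) \<star> (\<lambda>n. real n powr a)"
    by (simp add: tw_conv tw_id b_def)
  have "A s x (phi b) = (\<Sum>k = 1..nat \<lfloor>x\<rfloor>.
      L * tw (g \<star> id_pow (real s)) k - L * tw (g \<star> one) k
      - real s / 2 * tw (g \<star> (\<lambda>n. ln (real n))) k)"
    unfolding A_def
  proof (rule sum.cong)
    fix k assume "k \<in> {1..nat \<lfloor>x\<rfloor>}"
    hence k: "k > 0" by simp
    show "1 / real k ^ s * (\<Sum>j = 1..k ^ s. ln (Gamma (real j / real (k ^ s))) *
           (\<Sum>d | d dvd k \<and> d ^ s dvd j. (phi b \<star> moebius_mu) d)) =
        L * tw (g \<star> id_pow (real s)) k - L * tw (g \<star> one) k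
        - real s / 2 * tw (g \<star> (\<lambda>n. ln (real n))) k"
      unfolding sum_ln_Gamma_dirichlet_conv[OF k]
      using k by (simp add: tw_def powr_neg_of_nat L_def one_def g_def field_simps)
  qed simp
  also have "\<dots> = L * (\<Sum>k = 1..nat \<lfloor>x\<rfloor>. (tw (moebius_mu \<star> moebius_mu) \<star> sigma a) k)
      - L * (\<Sum>k = 1..nat \<lfloor>x\<rfloor>. (tw moebius_mu \<star> (\<lambda>n. real n powr a)) k)
      - real s / 2 * (\<Sum>k = 1..nat \<lfloor>x\<rfloor>. (tw (moebius_mu \<star> mangoldt) \<star> (\<lambda>n. real n powr a)) k)"
    by (simp add: 1 2 3 sum_subtractf sum_distrib_left)
  finally have A: "A s x (phi b) = L * (\<Sum>k = 1..nat \<lfloor>x\<rfloor>. (tw (moebius_mu \<star> moebius_mu) \<star> sigma a) k)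
      - L * (\<Sum>k = 1..nat \<lfloor>x\<rfloor>. (tw moebius_mu \<star> (\<lambda>n. real n powr a)) k)
      - real s / 2 * (\<Sum>k = 1..nat \<lfloor>x\<rfloor>. (tw (moebius_mu \<star> mangoldt) \<star> (\<lambda>n. real n powr a)) k)" .
  have "(\<Sum>k = 1..nat \<lfloor>x\<rfloor>. (tw f \<star> h) k) =
      (\<Sum>d = 1..nat \<lfloor>x\<rfloor>. f d / real d ^ s * (\<Sum>n = 1..nat \<lfloor>x / real d\<rfloor>. h n))" for f h
    unfolding sum_dirichlet_conv by (intro sum.cong) (auto simp: tw_def powr_neg_of_nat)
  thus ?thesis
    by (simp only: A L_def)
qed

subsection \<open>Truncation of Dirichlet series\<close>

text \<open>Growth of at most a double pole at 1, with one \<open>K\<close> for all \<open>e\<close>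
  in \<open>(0, 1]\<close>, so that \<open>e\<close> may later depend on \<open>x\<close>.\<close>

definition double_pole_bound :: "(nat \<Rightarrow> real) \<Rightarrow> real \<Rightarrow> bool" where
  "double_pole_bound c K \<longleftrightarrow>
     (\<forall>e. 0 < e \<longrightarrow> e \<le> 1 \<longrightarrow> (\<exists>B \<le> K / e ^ 2. has_dseries (\<lambda>n. \<bar>c n\<bar>) (1 + e) B))"

lemma double_pole_boundI:
  assumes "\<And>e. 0 < e \<Longrightarrow> e \<le> 1 \<Longrightarrow> \<exists>B \<le> K / e ^ 2. has_dseries g (1 + e) B"
    and "\<And>n. n > 0 \<Longrightarrow> \<bar>c n\<bar> \<le> g n"
  shows "double_pole_bound c K"
  unfolding double_pole_bound_def
proof (intro allI impI)
  fix e :: real assume e: "0 < e" "e \<le> 1"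
  obtain B where B: "B \<le> K / e ^ 2" "has_dseries g (1 + e) B"
    using assms(1)[OF e] by blast
  obtain S where "has_dseries (\<lambda>n. \<bar>c n\<bar>) (1 + e) S" "\<bar>S\<bar> \<le> B"
    by (rule has_dseries_comparison'[OF B(2), of "\<lambda>n. \<bar>c n\<bar>"]) (use assms(2) in auto)
  thus "\<exists>B\<le>K / e\<^sup>2. has_dseries (\<lambda>n. \<bar>c n\<bar>) (1 + e) B"
    using B(1) by (intro exI[of _ S]) auto
qed

lemma zeta_real_le': "0 < e \<Longrightarrow> e \<le> 1 \<Longrightarrow> zeta_real (1 + e) \<le> 2 / e"
  using zeta_real_le[of e] by (simp add: field_simps)

lemma double_pole_bound_moebius_mu: "double_pole_bound moebius_mu 2"
proof (rule double_pole_boundI[where g = "\<lambda>_. 1"])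
  fix e :: real assume e: "0 < e" "e \<le> 1"
  have "2 * (1 / e) \<le> 2 * (1 / e ^ 2)"
    using e by (intro mult_left_mono) (auto simp: field_simps power2_eq_square)
  thus "\<exists>B \<le> 2 / e ^ 2. has_dseries (\<lambda>_. 1) (1 + e) B"
    using e has_dseries_zeta[of "1 + e"] zeta_real_le'[of e]
    by (intro exI[of _ "zeta_real (1 + e)"]) auto
qed (rule abs_moebius_mu_le)

text \<open>The majorant is the divisor function, whose series is the square of zeta, and
  \<open>zeta_real (1 + e) \<le> 2 / e\<close>.\<close>

lemma double_pole_bound_moebius_mu_moebius_mu: "double_pole_bound (moebius_mu \<star> moebius_mu) 4"
proof (rule double_pole_boundI[where g = "(\<lambda>_. 1) \<star> (\<lambda>_. 1)"])
  fix e :: real assume e: "0 < e" "e \<le> 1"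
  have z: "has_dseries (\<lambda>_. 1) (1 + e) (zeta_real (1 + e))"
    using e by (intro has_dseries_zeta) auto
  hence "0 \<le> zeta_real (1 + e)"
    by (rule has_dseries_nonneg) simp
  hence "zeta_real (1 + e) * zeta_real (1 + e) \<le> (2 / e) * (2 / e)"
    using zeta_real_le'[OF e] e by (intro mult_mono) auto
  thus "\<exists>B \<le> 4 / e ^ 2. has_dseries ((\<lambda>_. 1) \<star> (\<lambda>_. 1)) (1 + e) B"
    using has_dseries_dirichlet_conv[OF z z]
    by (intro exI[of _ "zeta_real (1 + e) * zeta_real (1 + e)"]) (auto simp: power2_eq_square)
qed (intro abs_dirichlet_conv_le abs_moebius_mu_le)

text \<open>The majorant is the logarithm. Half of \<open>e\<close> pays for
  \<open>ln n \<le> (2 / e) * n powr (e / 2)\<close>, the other half leaves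
  \<open>zeta_real (1 + e / 2) \<le> 4 / e\<close>; the product is \<open>8 / e ^ 2\<close>.\<close>

lemma double_pole_bound_moebius_mu_mangoldt: "double_pole_bound (moebius_mu \<star> mangoldt) 8"
proof (rule double_pole_boundI[where g = "\<lambda>n. ln (real n)"])
  fix e :: real assume e: "0 < e" "e \<le> 1"
  have z: "has_dseries (\<lambda>n. 2 / e * 1) (1 + e / 2) (2 / e * zeta_real (1 + e / 2))"
    using e by (intro has_dseries_cmult has_dseries_zeta) auto
  have "\<bar>ln (real n) * real n powr - (1 + e)\<bar> \<le> 2 / e * 1 * real n powr - (1 + e / 2)" if "n > 0" for n
  proof -
    have "ln (real n) \<le> real n powr (e / 2) / (e / 2)"
      using e that by (intro ln_powr_bound) auto
    hence "ln (real n) * real n powr - (1 + e) \<le> real n powr (e / 2) / (e / 2) * real n powr - (1 + e)"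
      by (intro mult_right_mono) auto
    also have "\<dots> = 2 / e * 1 * (real n powr (e / 2) * real n powr - (1 + e))"
      by simp
    also have "real n powr (e / 2) * real n powr - (1 + e) = real n powr - (1 + e / 2)"
      unfolding powr_add[symmetric] by (rule arg_cong[where f = "\<lambda>t. real n powr t"]) simp
    finally show ?thesis
      using that by (simp add: abs_mult)
  qed
  then obtain S where S: "has_dseries (\<lambda>n. ln (real n)) (1 + e) S" "\<bar>S\<bar> \<le> 2 / e * zeta_real (1 + e / 2)"
    by (rule has_dseries_comparison[OF z, of "\<lambda>n. ln (real n)" "1 + e"]) blast+
  have "2 / e * zeta_real (1 + e / 2) \<le> 2 / e * (2 / (e / 2))"
    using e by (intro mult_left_mono zeta_real_le') auto
  also have "\<dots> = 8 / e ^ 2"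
    by (simp add: power2_eq_square)
  finally show "\<exists>B \<le> 8 / e ^ 2. has_dseries (\<lambda>n. ln (real n)) (1 + e) B"
    using S by (intro exI[of _ S]) auto
next
  fix n :: nat assume "n > 0"
  have "\<bar>(moebius_mu \<star> mangoldt) n\<bar> \<le> ((\<lambda>_. 1) \<star> mangoldt) n"
    by (intro abs_dirichlet_conv_le abs_moebius_mu_le) simp
  thus "\<bar>(moebius_mu \<star> mangoldt) n\<bar> \<le> ln (real n)"
    by (simp add: dirichlet_conv_commute[of "\<lambda>_. 1"] mangoldt_conv_one)
qed

lemma double_pole_bound_summable:
  assumes "double_pole_bound c K" "t > 1"
  obtains B where "has_dseries (\<lambda>n. \<bar>c n\<bar>) t B"
proof -
  define e where "e = min 1 (t - 1)"
  have "0 < e" "e \<le> 1" "1 + e \<le> t" using assms by (auto simp: e_def)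
  then obtain B where B: "has_dseries (\<lambda>n. \<bar>c n\<bar>) (1 + e) B"
    using assms(1) unfolding double_pole_bound_def by blast
  have "\<bar>\<bar>c n\<bar> * real n powr - t\<bar> \<le> \<bar>c n\<bar> * real n powr - (1 + e)" if "n > 0" for n
    using that \<open>1 + e \<le> t\<close> by (auto simp: abs_mult intro!: mult_left_mono powr_mono)
  then obtain S where S: "has_dseries (\<lambda>n. \<bar>c n\<bar>) t S"
    by (rule has_dseries_comparison[OF B, of "\<lambda>n. \<bar>c n\<bar>" t]) blast+
  thus ?thesis
    by (rule that)
qed

section \<open>Completing the truncated sums over \<open>d\<close>\<close>

lemma powr_inverse_ln_le:
  fixes x :: real
  assumes "x \<ge> 1"
  shows "x powr (1 / (2 + ln x)) \<le> 3"
proof -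
  have "2 + ln x > 0"
    using assms by (intro add_pos_nonneg) auto
  hence "1 / (2 + ln x) * ln x \<le> 1"
    by (simp add: divide_le_eq)
  hence "exp (1 / (2 + ln x) * ln x) \<le> exp 1"
    by simp
  also have "\<dots> \<le> (3 :: real)"
    by (rule exp_le)
  finally show ?thesis
    using assms by (simp add: powr_def)
qed

text \<open>Rankin's trick with \<open>t - r = 1 + e\<close> and \<open>e = 1 / (2 + ln x)\<close>:
  then \<open>x powr - r\<close> is at most \<open>3 * x powr (1 - s)\<close>, and the series is at
  most \<open>K * (2 + ln x) ^ 2\<close>. The summand 2 keeps \<open>e\<close> below 1 down to
  \<open>x = 1\<close>.\<close>

lemma dseries_truncation_log:
  assumes K: "double_pole_bound c K" and x: "x \<ge> 1" and s: "s \<ge> 2"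
    and w: "\<And>n. real n > x \<Longrightarrow> \<bar>w n\<bar> \<le> W"
    and T: "has_dseries (\<lambda>n. c n * w n) (real s) T"
  shows "\<bar>(\<Sum>n = 1..nat \<lfloor>x\<rfloor>. c n / real n ^ s * w n) - T\<bar>
           \<le> 3 * W * K * (x powr (1 - real s) * (2 + ln x) ^ 2)"
proof -
  define e where "e = 1 / (2 + ln x)"
  define r where "r = real s - 1 - e"
  have lnx: "ln x \<ge> 0" using x by simp
  hence e: "0 < e" "e \<le> 1"
    by (auto simp: e_def field_simps)
  hence r: "r \<ge> 0"
    using s by (simp add: r_def)
  obtain m :: nat where m: "real m > x"
    using reals_Archimedean2 by blast
  \<comment> \<open>The sign of \<open>W\<close> is read off at any single integer beyond
    \<open>x\<close>.\<close>
  have W: "W \<ge> 0"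
    using w[OF m] by linarith
  obtain B where B: "B \<le> K / e ^ 2" "has_dseries (\<lambda>n. \<bar>c n\<bar>) (1 + e) B"
    using K e unfolding double_pole_bound_def by blast
  have "\<bar>(\<Sum>n = 1..nat \<lfloor>x\<rfloor>. c n * w n * real n powr - real s) - T\<bar> \<le> W * x powr - r * B"
  proof (rule dseries_truncation[OF x W _ _ T])
    show "has_dseries (\<lambda>n. \<bar>c n\<bar>) (real s - r) B"
      using B(2) by (simp add: r_def)
  next
    fix n assume n: "real n > x"
    hence "1 \<le> (real n / x) powr r"
      using x r by (intro ge_one_powr_ge_zero) auto
    thus "\<bar>w n\<bar> \<le> W * (real n / x) powr r"
      using w[OF n] mult_left_mono[of 1 "(real n / x) powr r" W] W by linarith
  qed
  also have "(\<Sum>n = 1..nat \<lfloor>x\<rfloor>. c n * w n * real n powr - real s) =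
      (\<Sum>n = 1..nat \<lfloor>x\<rfloor>. c n / real n ^ s * w n)"
    by (intro sum.cong) (auto simp: powr_neg_of_nat)
  also have "W * x powr - r * B \<le> W * (x powr (1 - real s) * 3) * (K / e ^ 2)"
  proof (rule mult_mono)
    have "x powr - r = x powr (1 - real s) * x powr e"
      unfolding powr_add[symmetric] by (rule arg_cong[where f = "\<lambda>t. x powr t"]) (simp add: r_def)
    also have "\<dots> \<le> x powr (1 - real s) * 3"
      using powr_inverse_ln_le[OF x] by (intro mult_left_mono) (auto simp: e_def)
    finally show "W * x powr - r \<le> W * (x powr (1 - real s) * 3)"
      using W by (simp add: mult_left_mono)
    show "B \<ge> 0"
      using B(2) by (rule has_dseries_nonneg) simp
  qed (use B W in auto)
  also have "\<dots> = 3 * W * K * (x powr (1 - real s) * (2 + ln x) ^ 2)"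
    by (simp add: e_def power_divide)
  finally show ?thesis .
qed

text \<open>Here \<open>r = - a\<close>, so the majorant is the convergent series at the fixed
  exponent \<open>s + a\<close> and no logarithm appears.\<close>

lemma dseries_truncation_powr:
  assumes B: "has_dseries (\<lambda>n. \<bar>c n\<bar>) (real s + a) B" and x: "x \<ge> 1" and a: "a \<le> 0"
    and w: "\<And>n. real n > x \<Longrightarrow> \<bar>w n\<bar> \<le> W"
    and T: "has_dseries (\<lambda>n. c n * w n) (real s) T"
  shows "\<bar>(\<Sum>n = 1..nat \<lfloor>x\<rfloor>. c n / real n ^ s * w n) - T\<bar> \<le> W * B * x powr a"
proof -
  obtain m :: nat where m: "real m > x"
    using reals_Archimedean2 by blast
  have W: "W \<ge> 0"
    using w[OF m] by linarith
  have "\<bar>(\<Sum>n = 1..nat \<lfloor>x\<rfloor>. c n * w n * real n powr - real s) - T\<bar> \<le> W * x powr - (- a) * B"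
  proof (rule dseries_truncation[OF x W _ _ T])
    show "has_dseries (\<lambda>n. \<bar>c n\<bar>) (real s - (- a)) B"
      using B by simp
  next
    fix n assume n: "real n > x"
    hence "1 \<le> (real n / x) powr - a"
      using x a by (intro ge_one_powr_ge_zero) auto
    thus "\<bar>w n\<bar> \<le> W * (real n / x) powr - a"
      using w[OF n] mult_left_mono[of 1 "(real n / x) powr - a" W] W by linarith
  qed
  also have "(\<Sum>n = 1..nat \<lfloor>x\<rfloor>. c n * w n * real n powr - real s) =
      (\<Sum>n = 1..nat \<lfloor>x\<rfloor>. c n / real n ^ s * w n)"
    by (intro sum.cong) (auto simp: powr_neg_of_nat)
  finally show ?thesis
    by (simp add: mult_ac)
qed

lemma has_dseries_powr_weight:
  assumes "has_dseries c (t + q) S" "x > 0"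
  shows "has_dseries (\<lambda>n. c n * (x / real n) powr q) t (x powr q * S)"
proof -
  have "((\<lambda>n. x powr q * (c n * real n powr - (t + q))) has_sum (x powr q * S)) {1..}"
    using assms(1) unfolding has_dseries_def by (rule has_sum_cmult_right)
  also have "?this \<longleftrightarrow> ?thesis"
    unfolding has_dseries_def
    by (intro has_sum_cong)
       (use assms(2) in \<open>auto simp: powr_divide powr_minus powr_diff field_simps\<close>)
  finally show ?thesis .
qed

text \<open>Two errors arise. Replacing the inner sums by their expansion \<open>w\<close> costs at
  most \<open>B * x powr a\<close>, as \<open>(x / d) powr a / d ^ s\<close> equals
  \<open>x powr a * d powr - (s + a)\<close>; completing the sum over \<open>d\<close> is
  \<open>dseries_truncation_powr\<close>.\<close>

lemma dseries_powr_sum: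
  assumes a: "-1 < a" "a < 0" and x: "x \<ge> 1" and s: "s \<ge> 2"
    and B: "has_dseries (\<lambda>n. \<bar>c n\<bar>) (real s + a) B"
    and F: "has_dseries c (real s + a + 1) F" and F': "has_dseries c (real s) F'"
  shows "\<bar>(\<Sum>d = 1..nat \<lfloor>x\<rfloor>. c d / real d ^ s * (\<Sum>n = 1..nat \<lfloor>x / real d\<rfloor>. real n powr a)) -
           (x powr (1 + a) / (1 + a) * F + zeta_real (- a) * F')\<bar>
         \<le> (1 / (1 + a) + \<bar>zeta_real (- a)\<bar> + 1) * B * x powr a"
proof -
  define z where "z = zeta_real (- a)"
  define w where "w d = 1 / (1 + a) * (x / real d) powr (1 + a) + z" for d
  define P where "P y = (\<Sum>n = 1..nat \<lfloor>y\<rfloor>. real n powr a)" for y :: real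
  have "has_dseries (\<lambda>n. 1 / (1 + a) * (c n * (x / real n) powr (1 + a)) + z * c n) (real s)
      (1 / (1 + a) * (x powr (1 + a) * F) + z * F')"
    using F F' x
    by (intro has_dseries_add has_dseries_cmult has_dseries_powr_weight) (auto simp: algebra_simps)
  also have "(\<lambda>n. 1 / (1 + a) * (c n * (x / real n) powr (1 + a)) + z * c n) = (\<lambda>n. c n * w n)"
    by (simp add: w_def algebra_simps)
  finally have T: "has_dseries (\<lambda>n. c n * w n) (real s) (x powr (1 + a) / (1 + a) * F + z * F')"
    by simp
  have 1: "\<bar>(\<Sum>n = 1..nat \<lfloor>x\<rfloor>. c n / real n ^ s * w n) - (x powr (1 + a) / (1 + a) * F + z * F')\<bar>
      \<le> (1 / (1 + a) + \<bar>z\<bar>) * B * x powr a"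
  proof (rule dseries_truncation_powr[OF B x _ _ T])
    fix n assume "real n > x"
    hence "(x / real n) powr (1 + a) \<le> 1"
      using x a by (intro powr_le1) auto
    hence "1 / (1 + a) * (x / real n) powr (1 + a) \<le> 1 / (1 + a) * 1"
      using a by (intro mult_left_mono) auto
    moreover have "0 \<le> 1 / (1 + a) * (x / real n) powr (1 + a)"
      using a by simp
    ultimately show "\<bar>w n\<bar> \<le> 1 / (1 + a) + \<bar>z\<bar>"
      unfolding w_def by linarith
  qed (use a in auto)
  have "\<bar>(\<Sum>d = 1..nat \<lfloor>x\<rfloor>. c d / real d ^ s * (P (x / real d) - w d))\<bar>
      \<le> (\<Sum>d = 1..nat \<lfloor>x\<rfloor>. x powr a * (\<bar>c d\<bar> * real d powr - (real s + a)))"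
  proof (rule order.trans[OF sum_abs sum_mono])
    fix d assume "d \<in> {1..nat \<lfloor>x\<rfloor>}"
    hence "d > 0" "d \<le> nat \<lfloor>x\<rfloor>"
      by auto
    hence d: "d > 0" "real d \<le> x"
      using x by linarith+
    have "\<bar>P (x / real d) - w d\<bar> \<le> (x / real d) powr a"
      using powr_sum_asymp[OF a, of "x / real d"] d by (simp add: P_def w_def z_def)
    hence "\<bar>c d / real d ^ s\<bar> * \<bar>P (x / real d) - w d\<bar> \<le> \<bar>c d / real d ^ s\<bar> * (x / real d) powr a"
      by (intro mult_left_mono) auto
    also have "\<bar>c d / real d ^ s\<bar> = \<bar>c d\<bar> * real d powr - real s"
      using d by (simp add: powr_neg_of_nat)
    also have "\<bar>c d\<bar> * real d powr - real s * (x / real d) powr a =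
        x powr a * (\<bar>c d\<bar> * real d powr - (real s + a))"
      using d x by (simp add: powr_divide powr_minus powr_diff field_simps)
    finally show "\<bar>c d / real d ^ s * (P (x / real d) - w d)\<bar> \<le>
        x powr a * (\<bar>c d\<bar> * real d powr - (real s + a))"
      using d by (simp add: abs_mult powr_neg_of_nat)
  qed
  also have "\<dots> = x powr a * (\<Sum>d = 1..nat \<lfloor>x\<rfloor>. \<bar>c d\<bar> * real d powr - (real s + a))"
    by (simp add: sum_distrib_left)
  also have "\<dots> \<le> x powr a * B"
    using B unfolding has_dseries_def
    by (intro mult_left_mono finite_sum_le_has_sum[where A = "{1..}"]) auto
  finally have 2: "\<bar>(\<Sum>d = 1..nat \<lfloor>x\<rfloor>. c d / real d ^ s * P (x / real d)) -
      (\<Sum>d = 1..nat \<lfloor>x\<rfloor>. c d / real d ^ s * w d)\<bar> \<le> x powr a * B"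
    by (simp add: right_diff_distrib sum_subtractf)
  have "(1 / (1 + a) + \<bar>z\<bar> + 1) * B * x powr a = (1 / (1 + a) + \<bar>z\<bar>) * B * x powr a + x powr a * B"
    by (simp add: algebra_simps)
  with 1 2 show ?thesis
    unfolding P_def z_def by linarith
qed

subsection \<open>Asymptotic formulas\<close>

lemma has_dseries_divide_of_nat:
  assumes "has_dseries c (t + 1) S"
  shows "has_dseries (\<lambda>n. c n / real n) t S"
proof -
  have "((\<lambda>n. c n * real n powr - (t + 1)) has_sum S) {1..} \<longleftrightarrow>
      ((\<lambda>n. c n / real n * real n powr - t) has_sum S) {1..}"
    by (rule has_sum_cong) (auto simp: powr_diff powr_minus field_simps)
  thus ?thesis
    using assms unfolding has_dseries_def by simp
qed

text \<open>A rearranged definition of \<open>Delta\<close>; no estimate for the divisor problem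
  enters.\<close>

lemma sum_sigma_0:
  "(\<Sum>n = 1..nat \<lfloor>y\<rfloor>. sigma 0 n) = y * ln y + (2 * euler_mascheroni - 1) * y + Delta y"
proof -
  have "sigma 0 n = tau n" if "n > 0" for n
  proof -
    have "sigma 0 n = (\<Sum>d | d dvd n. 1)"
      unfolding sigma_def using that by (intro sum.cong) auto
    thus ?thesis
      by (simp add: tau_def)
  qed
  hence "(\<Sum>n = 1..nat \<lfloor>y\<rfloor>. sigma 0 n) = (\<Sum>n = 1..nat \<lfloor>y\<rfloor>. tau n)"
    by (intro sum.cong) auto
  thus ?thesis
    by (simp add: Delta_def)
qed

lemma sum_powr_0:
  assumes "y \<ge> 0"
  shows "(\<Sum>n = 1..nat \<lfloor>y\<rfloor>. real n powr 0) = y - 1 / 2 - vartheta y"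
proof -
  have "(\<Sum>n = 1..nat \<lfloor>y\<rfloor>. real n powr 0) = (\<Sum>n = 1..nat \<lfloor>y\<rfloor>. 1)"
    by (intro sum.cong) auto
  thus ?thesis
    using assms by (simp add: vartheta_def)
qed

text \<open>In \<open>A_phi_eq\<close> with \<open>a = 0\<close>, the sums over \<open>Delta\<close>
  and \<open>vartheta\<close> are kept as they stand; only the smooth weights \<open>w\<close> and
  \<open>v\<close> are completed to full series. The factor \<open>2 + ln x\<close> makes the bound
  hold from \<open>x = 1\<close> on.\<close>

lemma A_phi_asymp:
  fixes s :: nat and x L \<kappa> Z Z' z z' :: real
  assumes s: "s \<ge> 2" and x: "x \<ge> 1"
  defines "L \<equiv> ln (sqrt (2 * pi))" and "\<kappa> \<equiv> 2 * euler_mascheroni - 1"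
    and "Z \<equiv> zeta_real (real s + 1)" and "Z' \<equiv> zeta_real' (real s + 1)"
    and "z \<equiv> zeta_real (real s)" and "z' \<equiv> zeta_real' (real s)"
  shows "\<bar>A s x (phi (real s)) -
          (L / Z ^ 2 * x * ln x + s * Z' / (2 * Z ^ 2) * x
           + L / Z ^ 2 * (\<kappa> - 2 * (Z' / Z) - Z) * x
           + L * (\<Sum>d = 1..nat \<lfloor>x\<rfloor>. (moebius_mu \<star> moebius_mu) d / real d ^ s * Delta (x / real d))
           + s / 2 * (\<Sum>d = 1..nat \<lfloor>x\<rfloor>. (moebius_mu \<star> mangoldt) d / real d ^ s * vartheta (x / real d))
           - s * z' / (4 * z ^ 2) - L * D s x)\<bar>
        \<le> (12 * L * (1 + \<bar>\<kappa>\<bar>) + 6 * L + 12 * real s) * (x powr (1 - real s) * (2 + ln x) ^ 2)"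
proof -
  define E where "E = x powr (1 - real s) * (2 + ln x) ^ 2"
  define w where "w d = (x / real d) * ln (x / real d) + \<kappa> * (x / real d)" for d
  define v where "v d = x / real d - 1 / 2" for d
  define Sum where "Sum c h = (\<Sum>d = 1..nat \<lfloor>x\<rfloor>. c d / real d ^ s * h d)" for c h :: "nat \<Rightarrow> real"
  define \<Delta> where "\<Delta> d = Delta (x / real d)" for d
  define \<theta> where "\<theta> d = vartheta (x / real d)" for d
  note s1 = has_dseries_divide_of_nat[of _ "real s"]
  have t: "real s > 1" "real s + 1 > 1"
    using s by auto
  have nz: "Z \<noteq> 0" "z \<noteq> 0"
    unfolding Z_def z_def by (rule zeta_real_neq_0[OF t(2)], rule zeta_real_neq_0[OF t(1)])
  have L: "L \<ge> 0"
    using pi_ge_two by (simp add: L_def ln_sqrt)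
  have v_le: "\<bar>v n\<bar> \<le> 1" if "real n > x" for n
  proof -
    have "0 < x / real n" "x / real n < 1"
      using that x by auto
    thus ?thesis unfolding v_def by linarith
  qed
  have v_ser: "has_dseries (\<lambda>n. c n * v n) (real s) (x * F + - 1 / 2 * G)"
    if F: "has_dseries c (real s + 1) F" and G: "has_dseries c (real s) G" for c F G
  proof -
    have "has_dseries (\<lambda>n. x * (c n / real n) + - 1 / 2 * c n) (real s) (x * F + - 1 / 2 * G)"
      by (rule has_dseries_add[OF has_dseries_cmult[OF s1[OF F]] has_dseries_cmult[OF G]])
    thus ?thesis
      by (simp add: v_def algebra_simps)
  qed
  have 1: "\<bar>Sum (moebius_mu \<star> moebius_mu) w - (x * (ln x + \<kappa>) * (1 / Z ^ 2) + - x * (2 * Z' / Z ^ 3))\<bar>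
      \<le> 3 * (1 + \<bar>\<kappa>\<bar>) * 4 * E"
    unfolding Sum_def E_def
  proof (rule dseries_truncation_log[OF double_pole_bound_moebius_mu_moebius_mu x s])
    fix n assume n: "real n > x"
    define y where "y = real n / x"
    have y: "y > 1" "x / real n = 1 / y" using n x by (auto simp: y_def)
    have "ln y \<le> y" using ln_le_minus_one[of y] y by simp
    hence "\<bar>ln y / y\<bar> \<le> 1" "\<bar>\<kappa> / y\<bar> \<le> \<bar>\<kappa>\<bar>"
      using y mult_left_mono[of 1 y "\<bar>\<kappa>\<bar>"] by (auto simp: field_simps)
    moreover have "w n = - (ln y / y) + \<kappa> / y"
      using y by (simp add: w_def ln_div)
    ultimately show "\<bar>w n\<bar> \<le> 1 + \<bar>\<kappa>\<bar>" by linarith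
  next
    \<comment> \<open>Expanding \<open>ln (x / n)\<close> splits \<open>w n\<close> into
      \<open>x * (ln x + \<kappa>) / n\<close> and \<open>- x * ln n / n\<close>; the second part
      brings in the derivative of zeta.\<close>
    have "has_dseries (\<lambda>n. x * (ln x + \<kappa>) * ((moebius_mu \<star> moebius_mu) n / real n)
        + - x * ((moebius_mu \<star> moebius_mu) n * ln (real n) / real n)) (real s)
        (x * (ln x + \<kappa>) * (1 / Z ^ 2) + - x * (2 * Z' / Z ^ 3))"
      unfolding Z_def Z'_def
      by (rule has_dseries_add[OF has_dseries_cmult[OF s1] has_dseries_cmult[OF s1]])
         (use t(2) in \<open>rule has_dseries_moebius_mu_moebius_mu has_dseries_moebius_mu_moebius_mu_ln\<close>)+
    also have "?this \<longleftrightarrow> has_dseries (\<lambda>n. (moebius_mu \<star> moebius_mu) n * w n) (real s)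
        (x * (ln x + \<kappa>) * (1 / Z ^ 2) + - x * (2 * Z' / Z ^ 3))"
      by (rule has_dseries_cong) (use x in \<open>simp add: w_def ln_div field_simps\<close>)
    finally show "has_dseries (\<lambda>n. (moebius_mu \<star> moebius_mu) n * w n) (real s)
        (x * (ln x + \<kappa>) * (1 / Z ^ 2) + - x * (2 * Z' / Z ^ 3))" .
  qed
  have 2: "\<bar>Sum moebius_mu v - (x * (1 / Z) + - 1 / 2 * (1 / z))\<bar> \<le> 3 * 1 * 2 * E"
    unfolding Sum_def E_def Z_def z_def
    by (intro dseries_truncation_log[OF double_pole_bound_moebius_mu x s] v_le v_ser
        has_dseries_moebius_mu t)
  have 3: "\<bar>Sum (moebius_mu \<star> mangoldt) v - (x * (- Z' / Z ^ 2) + - 1 / 2 * (- z' / z ^ 2))\<bar> \<le> 3 * 1 * 8 * E"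
    unfolding Sum_def E_def Z_def z_def Z'_def z'_def
    by (intro dseries_truncation_log[OF double_pole_bound_moebius_mu_mangoldt x s] v_le v_ser
        has_dseries_moebius_mu_mangoldt t)
  have Sum_add: "Sum c (\<lambda>d. h d + k d) = Sum c h + Sum c k"
    and Sum_diff: "Sum c (\<lambda>d. h d - k d) = Sum c h - Sum c k" for c h k
    by (simp_all add: Sum_def distrib_left right_diff_distrib sum.distrib sum_subtractf)
  have sigma_sum: "(\<Sum>n = 1..nat \<lfloor>x / real d\<rfloor>. sigma 0 n) = w d + \<Delta> d" for d
    unfolding sum_sigma_0 w_def \<Delta>_def \<kappa>_def ..
  have powr_sum: "(\<Sum>n = 1..nat \<lfloor>x / real d\<rfloor>. real n powr 0) = v d - \<theta> d" for d
    unfolding v_def \<theta>_def using x by (intro sum_powr_0) auto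
  have "A s x (phi (real s)) = L * Sum (moebius_mu \<star> moebius_mu) (\<lambda>d. w d + \<Delta> d)
      - L * Sum moebius_mu (\<lambda>d. v d - \<theta> d) - real s / 2 * Sum (moebius_mu \<star> mangoldt) (\<lambda>d. v d - \<theta> d)"
    using A_phi_eq[of s x 0] unfolding sigma_sum powr_sum by (simp add: Sum_def L_def)
  also have "\<dots> = L * (Sum (moebius_mu \<star> moebius_mu) w + Sum (moebius_mu \<star> moebius_mu) \<Delta>)
      - L * (Sum moebius_mu v - Sum moebius_mu \<theta>)
      - real s / 2 * (Sum (moebius_mu \<star> mangoldt) v - Sum (moebius_mu \<star> mangoldt) \<theta>)"
    by (simp only: Sum_add Sum_diff)
  finally have A: "A s x (phi (real s)) = \<dots>" .
  \<comment> \<open>The constant in \<open>D\<close> is what the summand \<open>- 1 / 2\<close> of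
    \<open>v\<close> contributes against \<open>moebius_mu\<close>.\<close>
  have D: "D s x = - Sum moebius_mu \<theta> - 1 / (2 * z)"
    by (simp add: D_def Sum_def \<theta>_def z_def)
  define e1 where "e1 = Sum (moebius_mu \<star> moebius_mu) w - (x * (ln x + \<kappa>) * (1 / Z ^ 2) + - x * (2 * Z' / Z ^ 3))"
  define e2 where "e2 = Sum moebius_mu v - (x * (1 / Z) + - 1 / 2 * (1 / z))"
  define e3 where "e3 = Sum (moebius_mu \<star> mangoldt) v - (x * (- Z' / Z ^ 2) + - 1 / 2 * (- z' / z ^ 2))"
  have "A s x (phi (real s)) -
          (L / Z ^ 2 * x * ln x + s * Z' / (2 * Z ^ 2) * x
           + L / Z ^ 2 * (\<kappa> - 2 * (Z' / Z) - Z) * x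
           + L * Sum (moebius_mu \<star> moebius_mu) \<Delta> + s / 2 * Sum (moebius_mu \<star> mangoldt) \<theta>
           - s * z' / (4 * z ^ 2) - L * D s x) = L * e1 - L * e2 - s / 2 * e3"
    unfolding A D e1_def e2_def e3_def using nz
    by (simp add: field_simps power2_eq_square power3_eq_cube)
  moreover have "\<bar>L * e1 - L * e2 - s / 2 * e3\<bar> \<le> \<bar>L * e1\<bar> + \<bar>L * e2\<bar> + \<bar>s / 2 * e3\<bar>"
    by linarith
  moreover have "\<bar>L * e1\<bar> \<le> L * (3 * (1 + \<bar>\<kappa>\<bar>) * 4 * E)" "\<bar>L * e2\<bar> \<le> L * (3 * 1 * 2 * E)"
      "\<bar>s / 2 * e3\<bar> \<le> s / 2 * (3 * 1 * 8 * E)"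
    using mult_left_mono[OF 1[folded e1_def] L] mult_left_mono[OF 2[folded e2_def] L]
      mult_left_mono[OF 3[folded e3_def], of "s / 2"] L
    by (simp_all only: abs_mult abs_of_nonneg abs_of_nat abs_numeral abs_divide)
  \<comment> \<open>The numbers 4, 2 and 8 are the double-pole constants of the three coefficient
    functions, and 3 comes from \<open>powr_inverse_ln_le\<close>.\<close>
  moreover have "L * (3 * (1 + \<bar>\<kappa>\<bar>) * 4 * E) + L * (3 * 1 * 2 * E) + s / 2 * (3 * 1 * 8 * E) =
      (12 * L * (1 + \<bar>\<kappa>\<bar>) + 6 * L + 12 * real s) * E"
    by (simp add: algebra_simps)
  ultimately show ?thesis
    unfolding Sum_def \<Delta>_def \<theta>_def E_def by linarith
qed

text \<open>The sum over \<open>Delta_sigma\<close> is kept as it stands and the smooth part of the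
  \<open>sigma a\<close> sum is completed; the other two sums fall under
  \<open>dseries_powr_sum\<close>. Fixing \<open>B1\<close>, \<open>B2\<close>, \<open>B3\<close> by
  hypotheses makes the constant visibly independent of \<open>x\<close>.\<close>

lemma A_phi_add_asymp:
  fixes s :: nat and a x L \<alpha> \<beta> \<eta> Z Y Y' z z' :: real
  assumes s: "s \<ge> 2" and x: "x \<ge> 1" and a: "-1 < a" "a < 0"
  assumes B1: "has_dseries (\<lambda>n. \<bar>(moebius_mu \<star> moebius_mu) n\<bar>) (real s + a) B1"
    and B2: "has_dseries (\<lambda>n. \<bar>moebius_mu n\<bar>) (real s + a) B2"
    and B3: "has_dseries (\<lambda>n. \<bar>(moebius_mu \<star> mangoldt) n\<bar>) (real s + a) B3"
  defines "L \<equiv> ln (sqrt (2 * pi))"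
    and "\<alpha> \<equiv> zeta_real (1 - a)" and "\<beta> \<equiv> zeta_real (1 + a)" and "\<eta> \<equiv> zeta_real (- a)"
    and "Z \<equiv> zeta_real (real s + 1)"
    and "Y \<equiv> zeta_real (real s + a + 1)" and "Y' \<equiv> zeta_real' (real s + a + 1)"
    and "z \<equiv> zeta_real (real s)" and "z' \<equiv> zeta_real' (real s)"
  shows "\<bar>A s x (phi (real s + a)) -
          (L * \<alpha> / Z ^ 2 * x + s * Y' / (2 * (1 + a) * Y ^ 2) * x powr (1 + a)
           + L / (1 + a) * (\<beta> / Y ^ 2 - 1 / Y) * x powr (1 + a)
           + L * (\<Sum>d = 1..nat \<lfloor>x\<rfloor>. (moebius_mu \<star> moebius_mu) d / real d ^ s * Delta_sigma a (x / real d))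
           - \<eta> / (2 * z ^ 2) * L - \<eta> / z * (L - s * z' / (2 * z)))\<bar>
        \<le> (L * ((\<bar>\<alpha>\<bar> + \<bar>\<beta> / (1 + a)\<bar> + \<bar>\<eta> / 2\<bar>) * B1)
           + L * ((1 / (1 + a) + \<bar>\<eta>\<bar> + 1) * B2) + s / 2 * ((1 / (1 + a) + \<bar>\<eta>\<bar> + 1) * B3)) * x powr a"
proof -
  define Sum where "Sum c h = (\<Sum>d = 1..nat \<lfloor>x\<rfloor>. c d / real d ^ s * h d)" for c h :: "nat \<Rightarrow> real"
  define w where "w d = \<alpha> * (x / real d) + \<beta> / (1 + a) * (x / real d) powr (1 + a) + - \<eta> / 2" for d
  define \<Delta> where "\<Delta> d = Delta_sigma a (x / real d)" for d
  define P where "P d = (\<Sum>n = 1..nat \<lfloor>x / real d\<rfloor>. real n powr a)" for d :: nat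
  define X where "X = x powr (1 + a)"
  \<comment> \<open>Naming \<open>1 + a\<close> keeps it an atom when denominators are cleared
    below.\<close>
  define q where "q = 1 + a"
  have t: "real s > 1" "real s + 1 > 1" "real s + a + 1 > 1"
    using s a by auto
  have nz: "Z \<noteq> 0" "Y \<noteq> 0" "z \<noteq> 0" "1 + a \<noteq> 0"
    using a zeta_real_neq_0[OF t(1)] zeta_real_neq_0[OF t(2)] zeta_real_neq_0[OF t(3)]
    unfolding Z_def z_def Y_def by simp_all
  have L: "L \<ge> 0"
    using pi_ge_two by (simp add: L_def ln_sqrt)
  have 1: "\<bar>Sum (moebius_mu \<star> moebius_mu) w -
      (\<alpha> * (x * (1 / Z ^ 2)) + \<beta> / (1 + a) * (X * (1 / Y ^ 2)) + - \<eta> / 2 * (1 / z ^ 2))\<bar>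
      \<le> (\<bar>\<alpha>\<bar> + \<bar>\<beta> / (1 + a)\<bar> + \<bar>\<eta> / 2\<bar>) * B1 * x powr a"
    unfolding Sum_def
  proof (rule dseries_truncation_powr[OF B1 x])
    fix n assume n: "real n > x"
    hence y: "0 \<le> x / real n" "x / real n \<le> 1" using x by auto
    moreover have "(x / real n) powr (1 + a) \<le> 1"
      using y a by (intro powr_le1) auto
    ultimately have "\<bar>\<alpha> * (x / real n)\<bar> \<le> \<bar>\<alpha>\<bar> * 1"
        "\<bar>\<beta> / (1 + a) * (x / real n) powr (1 + a)\<bar> \<le> \<bar>\<beta> / (1 + a)\<bar> * 1"
      unfolding abs_mult by (intro mult_left_mono; simp)+
    thus "\<bar>w n\<bar> \<le> \<bar>\<alpha>\<bar> + \<bar>\<beta> / (1 + a)\<bar> + \<bar>\<eta> / 2\<bar>"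
      unfolding w_def by linarith
  next
    have "has_dseries (moebius_mu \<star> moebius_mu) (real s + 1) (1 / Z ^ 2)"
      and Y: "has_dseries (moebius_mu \<star> moebius_mu) (real s + (1 + a)) (1 / Y ^ 2)"
      and z: "has_dseries (moebius_mu \<star> moebius_mu) (real s) (1 / z ^ 2)"
      using has_dseries_moebius_mu_moebius_mu[OF t(1)] has_dseries_moebius_mu_moebius_mu[OF t(2)]
        has_dseries_moebius_mu_moebius_mu[OF t(3)]
      by (simp_all add: Z_def Y_def z_def algebra_simps)
    from has_dseries_cmult[OF has_dseries_divide_of_nat[OF this(1)], of x]
    have "has_dseries (\<lambda>n. (moebius_mu \<star> moebius_mu) n * (x / real n)) (real s) (x * (1 / Z ^ 2))"
      by (simp add: mult_ac)
    from has_dseries_add[OF has_dseries_add[OF has_dseries_cmult[OF this, of \<alpha>]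
          has_dseries_cmult[OF has_dseries_powr_weight[OF Y, of x], of "\<beta> / (1 + a)"]]
        has_dseries_cmult[OF z, of "- \<eta> / 2"]] x
    show "has_dseries (\<lambda>n. (moebius_mu \<star> moebius_mu) n * w n) (real s)
        (\<alpha> * (x * (1 / Z ^ 2)) + \<beta> / (1 + a) * (X * (1 / Y ^ 2)) + - \<eta> / 2 * (1 / z ^ 2))"
      by (simp add: w_def X_def algebra_simps)
  qed (use a in auto)
  have 2: "\<bar>Sum moebius_mu P - (X / (1 + a) * (1 / Y) + \<eta> * (1 / z))\<bar>
      \<le> (1 / (1 + a) + \<bar>\<eta>\<bar> + 1) * B2 * x powr a"
    unfolding Sum_def P_def X_def \<eta>_def Y_def z_def
    by (rule dseries_powr_sum[OF a x s B2 has_dseries_moebius_mu[OF t(3)] has_dseries_moebius_mu[OF t(1)]])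
  have 3: "\<bar>Sum (moebius_mu \<star> mangoldt) P - (X / (1 + a) * (- Y' / Y ^ 2) + \<eta> * (- z' / z ^ 2))\<bar>
      \<le> (1 / (1 + a) + \<bar>\<eta>\<bar> + 1) * B3 * x powr a"
    unfolding Sum_def P_def X_def \<eta>_def Y_def z_def Y'_def z'_def
    by (rule dseries_powr_sum[OF a x s B3 has_dseries_moebius_mu_mangoldt[OF t(3)]
          has_dseries_moebius_mu_mangoldt[OF t(1)]])
  have "(\<Sum>n = 1..nat \<lfloor>x / real d\<rfloor>. sigma a n) = w d + \<Delta> d" for d
    by (simp add: w_def \<Delta>_def Delta_sigma_def \<alpha>_def \<beta>_def \<eta>_def)
  hence A: "A s x (phi (real s + a)) = L * (Sum (moebius_mu \<star> moebius_mu) w + Sum (moebius_mu \<star> moebius_mu) \<Delta>)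
      - L * Sum moebius_mu P - real s / 2 * Sum (moebius_mu \<star> mangoldt) P"
    using A_phi_eq[of s x a] by (simp add: Sum_def P_def L_def distrib_left sum.distrib)
  define e1 where "e1 = Sum (moebius_mu \<star> moebius_mu) w -
      (\<alpha> * (x * (1 / Z ^ 2)) + \<beta> / (1 + a) * (X * (1 / Y ^ 2)) + - \<eta> / 2 * (1 / z ^ 2))"
  define e2 where "e2 = Sum moebius_mu P - (X / (1 + a) * (1 / Y) + \<eta> * (1 / z))"
  define e3 where "e3 = Sum (moebius_mu \<star> mangoldt) P - (X / (1 + a) * (- Y' / Y ^ 2) + \<eta> * (- z' / z ^ 2))"
  have main: "A s x (phi (real s + a)) -
          (L * \<alpha> / Z ^ 2 * x + s * Y' / (2 * (1 + a) * Y ^ 2) * X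
           + L / (1 + a) * (\<beta> / Y ^ 2 - 1 / Y) * X
           + L * Sum (moebius_mu \<star> moebius_mu) \<Delta>
           - \<eta> / (2 * z ^ 2) * L - \<eta> / z * (L - s * z' / (2 * z)))
        = L * e1 - L * e2 - s / 2 * e3"
    unfolding A e1_def e2_def e3_def q_def[symmetric] using nz[folded q_def]
    by (simp add: field_simps power2_eq_square)
  have triangle: "\<bar>L * e1 - L * e2 - s / 2 * e3\<bar> \<le> \<bar>L * e1\<bar> + \<bar>L * e2\<bar> + \<bar>s / 2 * e3\<bar>"
    by linarith
  have bounds: "\<bar>L * e1\<bar> \<le> L * ((\<bar>\<alpha>\<bar> + \<bar>\<beta> / (1 + a)\<bar> + \<bar>\<eta> / 2\<bar>) * B1 * x powr a)"
      "\<bar>L * e2\<bar> \<le> L * ((1 / (1 + a) + \<bar>\<eta>\<bar> + 1) * B2 * x powr a)"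
      "\<bar>s / 2 * e3\<bar> \<le> s / 2 * ((1 / (1 + a) + \<bar>\<eta>\<bar> + 1) * B3 * x powr a)"
    using mult_left_mono[OF 1[folded e1_def] L] mult_left_mono[OF 2[folded e2_def] L]
      mult_left_mono[OF 3[folded e3_def], of "s / 2"] L
    by (simp_all only: abs_mult abs_of_nonneg abs_of_nat abs_numeral abs_divide)
  show ?thesis
    using order.trans[OF triangle add_mono[OF add_mono[OF bounds(1,2)] bounds(3)]]
    unfolding main[unfolded Sum_def \<Delta>_def X_def] by (simp only: distrib_right mult.assoc)
qed

theorem theorem1:
  fixes a :: real and s :: nat
  assumes "-1 < a" and "a < 0" and "s \<ge> 2"
  shows
    "(\<forall>x\<^sub>0>1. \<exists>C. \<forall>x\<ge>x\<^sub>0.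
        \<bar>A s x (phi (real s)) -
          (ln (sqrt (2 * pi)) / zeta_real (s + 1) ^ 2 * x * ln x
           + s * zeta_real' (s + 1) / (2 * zeta_real (s + 1) ^ 2) * x
           + ln (sqrt (2 * pi)) / zeta_real (s + 1) ^ 2 *
               (2 * euler_mascheroni - 1 - 2 * (zeta_real' (s + 1) / zeta_real (s + 1))
                - zeta_real (s + 1)) * x
           + ln (sqrt (2 * pi)) *
               (\<Sum>d = 1..nat \<lfloor>x\<rfloor>. (moebius_mu \<star> moebius_mu) d / real d ^ s * Delta (x / real d))
           + s / 2 *
               (\<Sum>d = 1..nat \<lfloor>x\<rfloor>. (moebius_mu \<star> mangoldt) d / real d ^ s * vartheta (x / real d))
           - s * zeta_real' s / (4 * zeta_real s ^ 2)
           - ln (sqrt (2 * pi)) * D s x)\<bar>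
        \<le> C * (x powr (1 - real s) * (ln x) ^ 2)) \<and>
     (\<exists>C. \<forall>x>1.
        \<bar>A s x (phi (real s + a)) -
          (ln (sqrt (2 * pi)) * zeta_real (1 - a) / zeta_real (s + 1) ^ 2 * x
           + s * zeta_real' (s + a + 1) / (2 * (1 + a) * zeta_real (s + a + 1) ^ 2) * x powr (1 + a)
           + ln (sqrt (2 * pi)) / (1 + a) *
               (zeta_real (1 + a) / zeta_real (s + a + 1) ^ 2 - 1 / zeta_real (s + a + 1))
               * x powr (1 + a)
           + ln (sqrt (2 * pi)) *
               (\<Sum>d = 1..nat \<lfloor>x\<rfloor>. (moebius_mu \<star> moebius_mu) d / real d ^ s * Delta_sigma a (x / real d))
           - zeta_real (- a) / (2 * zeta_real s ^ 2) * ln (sqrt (2 * pi))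
           - zeta_real (- a) / zeta_real s *
               (ln (sqrt (2 * pi)) - s * zeta_real' s / (2 * zeta_real s)))\<bar>
        \<le> C * x powr a)"
proof (intro conjI allI impI, goal_cases)
  case (1 x\<^sub>0)
  define L where "L = ln (sqrt (2 * pi))"
  define K where "K = 12 * L * (1 + \<bar>2 * euler_mascheroni - 1\<bar>) + 6 * L + 12 * real s"
  have K: "K \<ge> 0"
    using pi_ge_two by (simp add: K_def L_def ln_sqrt)
  \<comment> \<open>On \<open>x \<ge> x\<^sub>0\<close> the ratio of \<open>2 + ln x\<close> to
    \<open>ln x\<close> is largest at \<open>x\<^sub>0\<close>; this is where the constant acquires
    its dependence on \<open>x\<^sub>0\<close>.\<close>
  have bound: "K * (x powr (1 - real s) * (2 + ln x) ^ 2)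
      \<le> K * (2 / ln x\<^sub>0 + 1) ^ 2 * (x powr (1 - real s) * (ln x) ^ 2)" if "x \<ge> x\<^sub>0" for x
  proof -
    have ln: "0 < ln x\<^sub>0" "ln x\<^sub>0 \<le> ln x"
      using 1 that by auto
    hence "2 \<le> 2 / ln x\<^sub>0 * ln x"
      by (simp add: field_simps)
    hence "2 + ln x \<le> (2 / ln x\<^sub>0 + 1) * ln x"
      by (simp add: distrib_right)
    hence "(2 + ln x) ^ 2 \<le> ((2 / ln x\<^sub>0 + 1) * ln x) ^ 2"
      using ln by (intro power_mono) auto
    hence "K * (x powr (1 - real s) * (2 + ln x) ^ 2)
        \<le> K * (x powr (1 - real s) * ((2 / ln x\<^sub>0 + 1) * ln x) ^ 2)"
      using K by (intro mult_left_mono) auto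
    thus ?thesis
      by (simp add: power_mult_distrib mult_ac)
  qed
  have s1: "real (s + 1) = real s + 1"
    by simp
  show ?case
    unfolding s1
  proof (rule exI[of _ "K * (2 / ln x\<^sub>0 + 1) ^ 2"], intro allI impI, goal_cases)
    case (1 x)
    have "x \<ge> 1"
      using 1 \<open>x\<^sub>0 > 1\<close> by simp
    from order.trans[OF A_phi_asymp[OF assms(3) this, folded L_def, folded K_def] bound[OF 1]]
    show ?case
      unfolding L_def .
  qed
next
  case 2
  \<comment> \<open>This places \<open>s + a\<close> in the region of absolute convergence of all
    three coefficient series.\<close>
  have t: "real s + a > 1"
    using assms by linarith
  obtain B1 where B1: "has_dseries (\<lambda>n. \<bar>(moebius_mu \<star> moebius_mu) n\<bar>) (real s + a) B1"
    by (rule double_pole_bound_summable[OF double_pole_bound_moebius_mu_moebius_mu t])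
  obtain B2 where B2: "has_dseries (\<lambda>n. \<bar>moebius_mu n\<bar>) (real s + a) B2"
    by (rule double_pole_bound_summable[OF double_pole_bound_moebius_mu t])
  obtain B3 where B3: "has_dseries (\<lambda>n. \<bar>(moebius_mu \<star> mangoldt) n\<bar>) (real s + a) B3"
    by (rule double_pole_bound_summable[OF double_pole_bound_moebius_mu_mangoldt t])
  have s1: "real (s + 1) = real s + 1"
    by simp
  show ?case
    unfolding s1
    \<comment> \<open>Unification reads the witness off the conclusion of
      \<open>A_phi_add_asymp\<close>, whose constant does not mention \<open>x\<close>.\<close>
    by (rule exI, intro allI impI, rule A_phi_add_asymp[OF assms(3) less_imp_le assms(1,2) B1 B2 B3])
qed

end
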